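(* Let $T=\mathfrak{T}^*$ be the dual of the original Tsirelson space $\mathfrak{T}$. There is a constant $B>0$ such that for each $n\geq2$ and all positive vectors $x_1,\ldots,x_n\in T$ (with no assumption on their supports), $$\|x_1+\cdots+x_n\|\geq\frac{\|x_1\|+\cdots+\|x_n\|}{B\log n}.$$
   Context: $T=\mathfrak{T}^*$ is the completion of $c_{00}$ (finitely supported scalar sequences) under the unique norm satisfying $$\|x\|=\max\Bigl\{\|x\|_{c_0},\ \tfrac12\sup\Bigl\{\sum_{j=1}^k\|E_jx\|:\ k\in\mathbb{N},\ \{k\}<E_1<\cdots<E_k\Bigr\}\Bigr\}\qquad(x\in c_{00}),$$ where $E_1,\dots,E_k$ are finite subsets of $\mathbb{N}$, $Ex=\mathbf{1}_E\cdot x$, and $E<F$ means $\max E<\min F$ or one of the sets is empty. The unit vectors form a normalized $1$-unconditional basis of $T$; a vector is positive if all its coordinates with respect to this basis are non-negative. *)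

theory Defs
  imports "HOL-Analysis.Analysis"
begin

section \<open>Finitely supported sequences\<close>

text \<open>Sequences are indexed by the positive integers; index \<open>0\<close> is a dummy index that
  always carries the value \<open>0\<close>.\<close>

typedef c00 = "{x :: nat \<Rightarrow> real. finite {i. x i \<noteq> 0} \<and> x 0 = 0}"
  morphisms entry Abs_c00
  by (rule exI[of _ "\<lambda>_. 0"]) simp

setup_lifting type_definition_c00

instantiation c00 :: real_vector
begin

lift_definition zero_c00 :: c00 is "\<lambda>_. 0" by simp

lift_definition plus_c00 :: "c00 \<Rightarrow> c00 \<Rightarrow> c00" is "\<lambda>x y i. x i + y i"
  subgoal for x y by (auto intro: finite_subset[of _ "{i. x i \<noteq> 0} \<union> {i. y i \<noteq> 0}"])
  done

lift_definition minus_c00 :: "c00 \<Rightarrow> c00 \<Rightarrow> c00" is "\<lambda>x y i. x i - y i"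
  subgoal for x y by (auto intro: finite_subset[of _ "{i. x i \<noteq> 0} \<union> {i. y i \<noteq> 0}"])
  done

lift_definition uminus_c00 :: "c00 \<Rightarrow> c00" is "\<lambda>x i. - x i" by simp

lift_definition scaleR_c00 :: "real \<Rightarrow> c00 \<Rightarrow> c00" is "\<lambda>a x i. a * x i"
  by (auto elim!: finite_subset[rotated])

instance
  by standard (transfer; auto simp: algebra_simps fun_eq_iff)+

end

text \<open>The unit vector \<open>unit_vec i\<close> is meaningful for \<open>i \<ge> 1\<close> only.\<close>

lift_definition unit_vec :: "nat \<Rightarrow> c00" is "\<lambda>i j. if i = j \<and> 1 \<le> i then 1 else 0"
  by (auto elim!: finite_subset[rotated])

lift_definition proj :: "nat set \<Rightarrow> c00 \<Rightarrow> c00" is "\<lambda>E x i. if i \<in> E then x i else 0"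
  by (auto elim!: finite_subset[rotated])

definition supp :: "c00 \<Rightarrow> nat set"
  where "supp x = {i. entry x i \<noteq> 0}"

definition c0_norm :: "c00 \<Rightarrow> real"
  where "c0_norm x = (SUP i. \<bar>entry x i\<bar>)"


section \<open>The norm\<close>

definition set_less :: "nat set \<Rightarrow> nat set \<Rightarrow> bool"
  where "set_less E F \<longleftrightarrow> E = {} \<or> F = {} \<or> Max E < Min F"

text \<open>The relation \<open>set_less\<close> is not transitive across empty sets, so the chain
  \<open>{k} < E\<^sub>1 < \<dots> < E\<^sub>k\<close> has to be read as a condition on all pairs.\<close>

definition admissible :: "nat \<Rightarrow> (nat \<Rightarrow> nat set) \<Rightarrow> bool"
  where "admissible k E \<longleftrightarrow> 1 \<le> k \<and>
    (\<forall>j\<in>{1..k}. finite (E j) \<and> set_less {k} (E j)) \<and>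
    (\<forall>i\<in>{1..k}. \<forall>j\<in>{1..k}. i < j \<longrightarrow> set_less (E i) (E j))"

definition adm_sums :: "(c00 \<Rightarrow> real) \<Rightarrow> c00 \<Rightarrow> real set"
  where "adm_sums N x = {(\<Sum>j=1..k. N (proj (E j) x)) | k E. admissible k E}"

definition is_norm :: "('a::real_vector \<Rightarrow> real) \<Rightarrow> bool"
  where "is_norm N \<longleftrightarrow> (\<forall>x. N x = 0 \<longleftrightarrow> x = 0) \<and>
    (\<forall>x y. N (x + y) \<le> N x + N y) \<and> (\<forall>a x. N (a *\<^sub>R x) = \<bar>a\<bar> * N x)"

definition is_tsirelson_norm :: "(c00 \<Rightarrow> real) \<Rightarrow> bool"
  where "is_tsirelson_norm N \<longleftrightarrow> is_norm N \<and>
    (\<forall>x. N x = max (c0_norm x) (1 / 2 * Sup (adm_sums N x)))"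

definition tsirelson_norm :: "c00 \<Rightarrow> real"
  where "tsirelson_norm = (THE N. is_tsirelson_norm N)"


subsection \<open>Existence and uniqueness of the norm\<close>

lemma entry_0 [simp]: "entry x 0 = 0"
  using entry[of x] by auto

lemma finite_supp [simp]: "finite (supp x)"
  using entry[of x] by (auto simp: supp_def)

lemma c00_eqI: "(\<And>i. entry x i = entry y i) \<Longrightarrow> x = y"
  by (metis entry_inject ext)

lemma entry_simps [simp]:
  "entry 0 i = 0" "entry (x + y) i = entry x i + entry y i"
  "entry (x - y) i = entry x i - entry y i" "entry (- x) i = - entry x i"
  "entry (a *\<^sub>R x) i = a * entry x i"
  "entry (proj E x) i = (if i \<in> E then entry x i else 0)"
  "entry (unit_vec n) i = (if n = i \<and> 1 \<le> n then 1 else 0)"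
  by (transfer; simp)+

lemma entry_sum: "entry (\<Sum>a\<in>A. f a) i = (\<Sum>a\<in>A. entry (f a) i)"
  by (induction A rule: infinite_finite_induct) auto

lemma proj_expansion: "proj E x = (\<Sum>i\<in>E \<inter> supp x. entry x i *\<^sub>R unit_vec i)"
proof (rule c00_eqI)
  fix i
  have "(\<Sum>a\<in>E \<inter> supp x. entry x a * (if a = i \<and> 1 \<le> a then 1 else 0)) =
        (\<Sum>a\<in>E \<inter> supp x. if a = i then entry x a else 0)"
    by (rule sum.cong) (auto simp: not_le)
  also have "\<dots> = (if i \<in> E \<inter> supp x then entry x i else 0)"
    by (rule sum.delta) simp
  also have "\<dots> = entry (proj E x) i"
    by (simp add: supp_def)
  finally show "entry (proj E x) i = entry (\<Sum>i\<in>E \<inter> supp x. entry x i *\<^sub>R unit_vec i) i"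
    by (simp add: entry_sum)
qed

lemma proj_linear: "proj E (x + y) = proj E x + proj E y" "proj E (a *\<^sub>R x) = a *\<^sub>R proj E x"
  "proj E (x - y) = proj E x - proj E y" "proj E 0 = 0"
  by (rule c00_eqI; simp)+

lemma bdd_entry: "bdd_above (range (\<lambda>i. \<bar>entry x i\<bar>))"
proof -
  have "range (\<lambda>i. \<bar>entry x i\<bar>) \<subseteq> insert 0 ((\<lambda>i. \<bar>entry x i\<bar>) ` supp x)"
    by (auto simp: supp_def)
  thus ?thesis
    by (meson bdd_above_finite finite.insertI finite_imageI finite_subset finite_supp)
qed

lemma entry_le_c0_norm: "\<bar>entry x i\<bar> \<le> c0_norm x"
  unfolding c0_norm_def by (rule cSUP_upper[OF UNIV_I bdd_entry])

lemma c0_norm_leI: "(\<And>i. \<bar>entry x i\<bar> \<le> c) \<Longrightarrow> c0_norm x \<le> c"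
  unfolding c0_norm_def by (rule cSUP_least) auto

lemma c0_norm_nonneg: "0 \<le> c0_norm x"
  using entry_le_c0_norm[of x 0] by simp

lemma c0_norm_eq_0D: "c0_norm x \<le> 0 \<Longrightarrow> x = 0"
  by (rule c00_eqI)
    (metis abs_le_zero_iff entry_le_c0_norm entry_simps(1) order_trans)

definition is_seminorm :: "(c00 \<Rightarrow> real) \<Rightarrow> bool"
  where "is_seminorm N \<longleftrightarrow>
    (\<forall>x y. N (x + y) \<le> N x + N y) \<and> (\<forall>a x. N (a *\<^sub>R x) = \<bar>a\<bar> * N x)"

lemma is_seminormD:
  assumes "is_seminorm N"
  shows "N (x + y) \<le> N x + N y" "N (a *\<^sub>R x) = \<bar>a\<bar> * N x" "N 0 = 0" "0 \<le> N x"
proof -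
  have tri: "N (x + y) \<le> N x + N y" and sc: "N (a *\<^sub>R x) = \<bar>a\<bar> * N x" for x y a
    using assms by (auto simp: is_seminorm_def)
  show "N (x + y) \<le> N x + N y" "N (a *\<^sub>R x) = \<bar>a\<bar> * N x" by (fact tri sc)+
  show z: "N 0 = 0" using sc[of 0 0] by simp
  show "0 \<le> N x" using tri[of x "(-1) *\<^sub>R x"] sc[of "-1" x] z by simp
qed

lemma is_seminorm_sum: "is_seminorm N \<Longrightarrow> N (\<Sum>a\<in>A. f a) \<le> (\<Sum>a\<in>A. N (f a))"
proof (induction A rule: infinite_finite_induct)
  case (insert a A)
  thus ?case using is_seminormD(1)[of N "f a" "\<Sum>a\<in>A. f a"] by force
qed (auto simp: is_seminormD)

lemma is_seminorm_lincomb: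
  assumes "is_seminorm N"
  shows "N (\<Sum>a\<in>A. c a *\<^sub>R v a) \<le> (\<Sum>a\<in>A. \<bar>c a\<bar> * N (v a))"
  using is_seminorm_sum[OF assms, of "\<lambda>a. c a *\<^sub>R v a" A] is_seminormD(2)[OF assms]
  by simp

lemma is_seminorm_c0: "is_seminorm c0_norm"
  unfolding is_seminorm_def
proof (intro conjI allI)
  fix x y a
  show "c0_norm (x + y) \<le> c0_norm x + c0_norm y"
  proof (rule c0_norm_leI)
    fix i
    show "\<bar>entry (x + y) i\<bar> \<le> c0_norm x + c0_norm y"
      using entry_le_c0_norm[of x i] entry_le_c0_norm[of y i] by simp
  qed
  have le: "c0_norm (b *\<^sub>R z) \<le> \<bar>b\<bar> * c0_norm z" for b z
    by (rule c0_norm_leI) (simp add: abs_mult entry_le_c0_norm mult_left_mono)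
  show "c0_norm (a *\<^sub>R x) = \<bar>a\<bar> * c0_norm x"
  proof (cases "a = 0")
    case True
    thus ?thesis using le[of 0 x] c0_norm_nonneg[of 0] by simp
  next
    case False
    have "\<bar>a\<bar> * c0_norm x \<le> \<bar>a\<bar> * (\<bar>inverse a\<bar> * c0_norm (a *\<^sub>R x))"
      using le[of "inverse a" "a *\<^sub>R x"] False by (intro mult_left_mono) auto
    also have "\<dots> = c0_norm (a *\<^sub>R x)" using False by (simp add: field_simps)
    finally show ?thesis using le[of a x] by simp
  qed
qed

lemma admissible_disjoint:
  assumes "admissible k E" "i \<in> {1..k}" "j \<in> {1..k}" "i \<noteq> j"
  shows "E i \<inter> E j = {}"
proof -
  have *: "E a \<inter> E b = {}" if "a \<in> {1..k}" "b \<in> {1..k}" "a < b" for a b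
  proof -
    have "set_less (E a) (E b)" "finite (E a)" "finite (E b)"
      using assms(1) that by (auto simp: admissible_def)
    have False if "c \<in> E a" "c \<in> E b" for c
    proof -
      have "Min (E b) \<le> Max (E a)"
        using that \<open>finite (E a)\<close> \<open>finite (E b)\<close> by (meson Max_ge Min_le order_trans)
      thus ?thesis using that \<open>set_less (E a) (E b)\<close> by (auto simp: set_less_def)
    qed
    thus ?thesis by blast
  qed
  show ?thesis using *[of i j] *[of j i] assms by (cases "i < j") auto
qed

lemma admissible_empty: "admissible 1 (\<lambda>_. {})"
  by (auto simp: admissible_def set_less_def)

lemma adm_sum_in: "admissible k E \<Longrightarrow> (\<Sum>j=1..k. N (proj (E j) x)) \<in> adm_sums N x"
  by (auto simp: adm_sums_def)

lemma adm_sums_nonempty: "adm_sums N x \<noteq> {}"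
  using adm_sum_in[OF admissible_empty] by blast

lemma adm_sum_le_l1:
  assumes N: "is_seminorm N" and E: "admissible k E"
  shows "(\<Sum>j=1..k. N (proj (E j) x)) \<le> (\<Sum>i\<in>supp x. \<bar>entry x i\<bar> * N (unit_vec i))"
proof -
  have "(\<Sum>j=1..k. N (proj (E j) x)) \<le>
        (\<Sum>j=1..k. \<Sum>i\<in>E j \<inter> supp x. \<bar>entry x i\<bar> * N (unit_vec i))"
  proof (rule sum_mono)
    fix j
    show "N (proj (E j) x) \<le> (\<Sum>i\<in>E j \<inter> supp x. \<bar>entry x i\<bar> * N (unit_vec i))"
      unfolding proj_expansion by (rule is_seminorm_lincomb[OF N])
  qed
  also have "\<dots> = (\<Sum>i\<in>(\<Union>j\<in>{1..k}. E j \<inter> supp x). \<bar>entry x i\<bar> * N (unit_vec i))"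
    by (rule sum.UNION_disjoint[symmetric]) (simp, simp, use admissible_disjoint[OF E] in blast)
  also have "\<dots> \<le> (\<Sum>i\<in>supp x. \<bar>entry x i\<bar> * N (unit_vec i))"
    by (rule sum_mono2) (auto simp: is_seminormD[OF N])
  finally show ?thesis .
qed

lemma bdd_adm_sums: "is_seminorm N \<Longrightarrow> bdd_above (adm_sums N x)"
  unfolding bdd_above_def adm_sums_def using adm_sum_le_l1 by blast

lemma adm_sum_le_Sup:
  "is_seminorm N \<Longrightarrow> admissible k E \<Longrightarrow> (\<Sum>j=1..k. N (proj (E j) x)) \<le> Sup (adm_sums N x)"
  by (rule cSup_upper[OF adm_sum_in bdd_adm_sums])

lemma Sup_adm_sums_leI:
  "(\<And>k E. admissible k E \<Longrightarrow> (\<Sum>j=1..k. N (proj (E j) x)) \<le> c) \<Longrightarrow> Sup (adm_sums N x) \<le> c"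
  by (rule cSup_least[OF adm_sums_nonempty]) (auto simp: adm_sums_def)

primrec norm_iter :: "nat \<Rightarrow> c00 \<Rightarrow> real" where
  "norm_iter 0 = c0_norm"
| "norm_iter (Suc m) = (\<lambda>x. max (c0_norm x) (1 / 2 * Sup (adm_sums (norm_iter m) x)))"

lemma c0_le_norm_iter: "c0_norm x \<le> norm_iter m x"
  by (cases m) auto

lemma is_seminorm_step:
  assumes N: "is_seminorm N"
  shows "is_seminorm (\<lambda>x. max (c0_norm x) (1 / 2 * Sup (adm_sums N x)))" (is "is_seminorm ?M")
  unfolding is_seminorm_def
proof (intro conjI allI)
  fix x y :: c00 and a :: real
  note c0 = is_seminormD[OF is_seminorm_c0] and n = is_seminormD[OF N]
  have "Sup (adm_sums N (x + y)) \<le> Sup (adm_sums N x) + Sup (adm_sums N y)"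
  proof (rule Sup_adm_sums_leI)
    fix k E assume E: "admissible k E"
    have "(\<Sum>j=1..k. N (proj (E j) (x + y))) \<le>
          (\<Sum>j=1..k. N (proj (E j) x) + N (proj (E j) y))"
      by (rule sum_mono) (simp add: proj_linear n)
    also have "\<dots> \<le> Sup (adm_sums N x) + Sup (adm_sums N y)"
      using adm_sum_le_Sup[OF N E] by (simp add: sum.distrib add_mono)
    finally show "(\<Sum>j=1..k. N (proj (E j) (x + y))) \<le> Sup (adm_sums N x) + Sup (adm_sums N y)" .
  qed
  thus "?M (x + y) \<le> ?M x + ?M y"
    using c0(1)[of x y] by (auto simp: max_def)
  have le: "Sup (adm_sums N (b *\<^sub>R z)) \<le> \<bar>b\<bar> * Sup (adm_sums N z)" for b z
  proof (rule Sup_adm_sums_leI)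
    fix k E assume E: "admissible k E"
    have "(\<Sum>j=1..k. N (proj (E j) (b *\<^sub>R z))) = \<bar>b\<bar> * (\<Sum>j=1..k. N (proj (E j) z))"
      by (simp add: proj_linear n sum_distrib_left)
    also have "\<dots> \<le> \<bar>b\<bar> * Sup (adm_sums N z)"
      using adm_sum_le_Sup[OF N E] by (simp add: mult_left_mono)
    finally show "(\<Sum>j=1..k. N (proj (E j) (b *\<^sub>R z))) \<le> \<bar>b\<bar> * Sup (adm_sums N z)" .
  qed
  have nonneg: "0 \<le> Sup (adm_sums N z)" for z
    using adm_sum_le_Sup[OF N admissible_empty, of z] n(4)[of "proj {} z"] by simp
  have "Sup (adm_sums N (a *\<^sub>R x)) = \<bar>a\<bar> * Sup (adm_sums N x)"
  proof (cases "a = 0")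
    case True
    thus ?thesis using le[of 0 x] nonneg[of 0] by simp
  next
    case False
    have "\<bar>a\<bar> * Sup (adm_sums N x) \<le> \<bar>a\<bar> * (\<bar>inverse a\<bar> * Sup (adm_sums N (a *\<^sub>R x)))"
      using le[of "inverse a" "a *\<^sub>R x"] False by (intro mult_left_mono) auto
    also have "\<dots> = Sup (adm_sums N (a *\<^sub>R x))" using False by (simp add: field_simps)
    finally show ?thesis using le[of a x] by simp
  qed
  thus "?M (a *\<^sub>R x) = \<bar>a\<bar> * ?M x"
    by (simp add: c0 max_mult_distrib_left)
qed

lemma is_seminorm_iter: "is_seminorm (norm_iter m)"
  by (induction m) (simp_all only: norm_iter.simps is_seminorm_c0 is_seminorm_step)

lemma norm_iter_unit: "norm_iter m (unit_vec i) \<le> 1"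
proof (induction m)
  case 0
  show ?case by (auto intro: c0_norm_leI)
next
  case (Suc m)
  have "Sup (adm_sums (norm_iter m) (unit_vec i)) \<le> 1"
  proof (rule Sup_adm_sums_leI)
    fix k E assume "admissible k E"
    note adm_sum_le_l1[OF is_seminorm_iter[of m] this, of "unit_vec i"]
    also have "(\<Sum>a\<in>supp (unit_vec i). \<bar>entry (unit_vec i) a\<bar> * norm_iter m (unit_vec a)) \<le>
        (\<Sum>a\<in>{i}. norm_iter m (unit_vec a))"
      by (rule order_trans[OF sum_mono2[of "{i}"]])
        (auto simp: supp_def is_seminormD[OF is_seminorm_iter] split: if_splits)
    also have "\<dots> \<le> 1" using Suc by simp
    finally show "(\<Sum>j=1..k. norm_iter m (proj (E j) (unit_vec i))) \<le> 1" .
  qed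
  moreover have "c0_norm (unit_vec i) \<le> 1" by (auto intro: c0_norm_leI)
  ultimately show ?case by simp
qed

lemma proj_supp: "proj (supp x) x = x"
  by (rule c00_eqI) (auto simp: supp_def)

lemma norm_iter_le_l1: "norm_iter m x \<le> (\<Sum>i\<in>supp x. \<bar>entry x i\<bar>)"
proof -
  have "norm_iter m x = norm_iter m (\<Sum>i\<in>supp x. entry x i *\<^sub>R unit_vec i)"
    using proj_expansion[of "supp x" x] by (simp add: proj_supp)
  also have "\<dots> \<le> (\<Sum>i\<in>supp x. \<bar>entry x i\<bar> * norm_iter m (unit_vec i))"
    by (rule is_seminorm_lincomb[OF is_seminorm_iter])
  also have "\<dots> \<le> (\<Sum>i\<in>supp x. \<bar>entry x i\<bar> * 1)"
    by (intro sum_mono mult_left_mono norm_iter_unit) auto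
  finally show ?thesis by simp
qed

lemma norm_iter_mono_Suc: "norm_iter m x \<le> norm_iter (Suc m) x"
proof (induction m arbitrary: x)
  case 0
  show ?case by simp
next
  case (Suc m)
  have "Sup (adm_sums (norm_iter m) x) \<le> Sup (adm_sums (norm_iter (Suc m)) x)"
  proof (rule Sup_adm_sums_leI)
    fix k E assume E: "admissible k E"
    have "(\<Sum>j=1..k. norm_iter m (proj (E j) x)) \<le> (\<Sum>j=1..k. norm_iter (Suc m) (proj (E j) x))"
      by (intro sum_mono Suc)
    also note adm_sum_le_Sup[OF is_seminorm_iter E]
    finally show "(\<Sum>j=1..k. norm_iter m (proj (E j) x)) \<le> Sup (adm_sums (norm_iter (Suc m)) x)" .
  qed
  thus ?case unfolding norm_iter.simps(2) by (intro max.mono mult_left_mono) auto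
qed

definition norm_lim :: "c00 \<Rightarrow> real"
  where "norm_lim x = (SUP m. norm_iter m x)"

lemma bdd_norm_iter: "bdd_above (range (\<lambda>m. norm_iter m x))"
  unfolding bdd_above_def using norm_iter_le_l1 by blast

lemma norm_iter_tendsto: "(\<lambda>m. norm_iter m x) \<longlonglongrightarrow> norm_lim x"
  unfolding norm_lim_def
  by (rule LIMSEQ_incseq_SUP[OF bdd_norm_iter]) (simp add: incseq_SucI norm_iter_mono_Suc del: norm_iter.simps)

lemma norm_iter_le_lim: "norm_iter m x \<le> norm_lim x"
  unfolding norm_lim_def by (rule cSUP_upper[OF UNIV_I bdd_norm_iter])

lemma is_seminorm_lim: "is_seminorm norm_lim"
  unfolding is_seminorm_def
proof (intro conjI allI)
  fix x y :: c00 and a :: real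
  show "norm_lim (x + y) \<le> norm_lim x + norm_lim y"
    by (rule LIMSEQ_le[OF norm_iter_tendsto tendsto_add[OF norm_iter_tendsto norm_iter_tendsto]])
      (auto simp: is_seminormD[OF is_seminorm_iter])
  have "(\<lambda>m. norm_iter m (a *\<^sub>R x)) \<longlonglongrightarrow> \<bar>a\<bar> * norm_lim x"
    by (simp add: is_seminormD[OF is_seminorm_iter] tendsto_mult_left norm_iter_tendsto)
  thus "norm_lim (a *\<^sub>R x) = \<bar>a\<bar> * norm_lim x"
    using LIMSEQ_unique norm_iter_tendsto by blast
qed

lemma is_tsirelson_norm_lim: "is_tsirelson_norm norm_lim"
  unfolding is_tsirelson_norm_def
proof (intro conjI allI)
  have c0: "c0_norm x \<le> norm_lim x" for x
    using c0_le_norm_iter norm_iter_le_lim order_trans by blast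
  show "is_norm norm_lim"
    using is_seminorm_lim is_seminormD[OF is_seminorm_lim] c0_norm_eq_0D c0
    unfolding is_norm_def is_seminorm_def by metis
  fix x
  have "Sup (adm_sums norm_lim x) \<le> 2 * norm_lim x"
  proof (rule Sup_adm_sums_leI)
    fix k E assume E: "admissible k E"
    have "(\<Sum>j=1..k. norm_iter m (proj (E j) x)) \<le> 2 * norm_lim x" for m
    proof -
      have "(\<Sum>j=1..k. norm_iter m (proj (E j) x)) \<le> 2 * norm_iter (Suc m) x"
        using adm_sum_le_Sup[OF is_seminorm_iter[of m] E, of x] by simp
      thus ?thesis using norm_iter_le_lim[of "Suc m" x] by linarith
    qed
    thus "(\<Sum>j=1..k. norm_lim (proj (E j) x)) \<le> 2 * norm_lim x"
      by (intro LIMSEQ_le_const2[OF tendsto_sum[OF norm_iter_tendsto]]) auto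
  qed
  moreover have "norm_lim x \<le> max (c0_norm x) (1 / 2 * Sup (adm_sums norm_lim x))"
  proof (rule LIMSEQ_le_const2[OF norm_iter_tendsto], intro exI allI impI)
    fix m
    have "Sup (adm_sums (norm_iter m) x) \<le> Sup (adm_sums norm_lim x)"
    proof (rule Sup_adm_sums_leI)
      fix k E assume E: "admissible k E"
      have "(\<Sum>j=1..k. norm_iter m (proj (E j) x)) \<le> (\<Sum>j=1..k. norm_lim (proj (E j) x))"
        by (intro sum_mono norm_iter_le_lim)
      also note adm_sum_le_Sup[OF is_seminorm_lim E]
      finally show "(\<Sum>j=1..k. norm_iter m (proj (E j) x)) \<le> Sup (adm_sums norm_lim x)" .
    qed
    hence "norm_iter (Suc m) x \<le> max (c0_norm x) (1 / 2 * Sup (adm_sums norm_lim x))"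
      by (auto simp: max_def)
    thus "norm_iter m x \<le> max (c0_norm x) (1 / 2 * Sup (adm_sums norm_lim x))"
      using norm_iter_mono_Suc order_trans by blast
  qed
  ultimately show "norm_lim x = max (c0_norm x) (1 / 2 * Sup (adm_sums norm_lim x))"
    using c0[of x] by (auto simp: max_def)
qed

lemma is_tsirelson_normD:
  assumes "is_tsirelson_norm N"
  shows "is_seminorm N" "N x = max (c0_norm x) (1 / 2 * Sup (adm_sums N x))"
  using assms by (auto simp: is_tsirelson_norm_def is_norm_def is_seminorm_def)

lemma tsirelson_norm_le:
  assumes M: "is_tsirelson_norm M" and N: "is_tsirelson_norm N"
  shows "M x \<le> N x"
proof (induction "card (supp x)" arbitrary: x rule: less_induct)
  case less
  note m = is_seminormD[OF is_tsirelson_normD(1)[OF M]]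
    and n = is_seminormD[OF is_tsirelson_normD(1)[OF N]]
  have "Sup (adm_sums M x) \<le> max (2 * N x) (M x)"
  proof (rule Sup_adm_sums_leI)
    fix k E assume E: "admissible k E"
    show "(\<Sum>j=1..k. M (proj (E j) x)) \<le> max (2 * N x) (M x)"
    proof (cases "\<exists>l\<in>{1..k}. supp x \<subseteq> E l")
      case True
      then obtain l where l: "l \<in> {1..k}" "supp x \<subseteq> E l" by blast
      have "M (proj (E j) x) = (if j = l then M x else 0)" if "j \<in> {1..k}" for j
      proof (cases "j = l")
        case True
        have "proj (E l) x = x"
          by (rule c00_eqI) (use l in \<open>auto simp: supp_def\<close>)
        thus ?thesis using True by simp
      next
        case False
        hence "proj (E j) x = 0"
          by (intro c00_eqI) (use l admissible_disjoint[OF E that l(1)] in \<open>auto simp: supp_def\<close>)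
        thus ?thesis using False m(3) by simp
      qed
      hence "(\<Sum>j=1..k. M (proj (E j) x)) = (\<Sum>j=1..k. if j = l then M x else 0)"
        by (intro sum.cong refl)
      hence "(\<Sum>j=1..k. M (proj (E j) x)) = M x" using l(1) by simp
      thus ?thesis by simp
    next
      case False
      have "(\<Sum>j=1..k. M (proj (E j) x)) \<le> (\<Sum>j=1..k. N (proj (E j) x))"
      proof (rule sum_mono)
        fix j assume "j \<in> {1..k}"
        hence "supp (proj (E j) x) \<subset> supp x" using False by (auto simp: supp_def split: if_splits)
        thus "M (proj (E j) x) \<le> N (proj (E j) x)" by (intro less psubset_card_mono) auto
      qed
      also have "\<dots> \<le> Sup (adm_sums N x)" by (rule adm_sum_le_Sup[OF is_tsirelson_normD(1)[OF N] E])
      also have "\<dots> \<le> 2 * N x" using is_tsirelson_normD(2)[OF N, of x] by linarith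
      finally show ?thesis by simp
    qed
  qed
  moreover have "c0_norm x \<le> N x" using is_tsirelson_normD(2)[OF N, of x] by linarith
  ultimately show ?case
    using is_tsirelson_normD(2)[OF M, of x] m(4)[of x] n(4)[of x] by linarith
qed

theorem ex1_tsirelson_norm: "\<exists>!N. is_tsirelson_norm N"
  using is_tsirelson_norm_lim tsirelson_norm_le by (metis ext order_antisym)

lemma is_tsirelson_norm: "is_tsirelson_norm tsirelson_norm"
  unfolding tsirelson_norm_def by (rule theI'[OF ex1_tsirelson_norm])

instantiation c00 :: real_normed_vector
begin

definition norm_c00 :: "c00 \<Rightarrow> real" where "norm_c00 = tsirelson_norm"
definition sgn_c00 :: "c00 \<Rightarrow> c00" where "sgn_c00 x = x /\<^sub>R norm x"
definition dist_c00 :: "c00 \<Rightarrow> c00 \<Rightarrow> real" where "dist_c00 x y = norm (x - y)"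
definition uniformity_c00 :: "(c00 \<times> c00) filter"
  where "uniformity_c00 = (INF e\<in>{0<..}. principal {(x, y). dist x y < e})"
definition open_c00 :: "c00 set \<Rightarrow> bool"
  where "open_c00 U \<longleftrightarrow> (\<forall>x\<in>U. eventually (\<lambda>(x', y). x' = x \<longrightarrow> y \<in> U) uniformity)"

instance
  by standard
    (use is_tsirelson_norm in \<open>auto simp: norm_c00_def sgn_c00_def dist_c00_def uniformity_c00_def
      open_c00_def is_tsirelson_norm_def is_norm_def\<close>)

end


section \<open>The completion of a normed space\<close>

definition completion_rel :: "(nat \<Rightarrow> 'a::real_normed_vector) \<Rightarrow> (nat \<Rightarrow> 'a) \<Rightarrow> bool"
  where "completion_rel X Y \<longleftrightarrow> Cauchy X \<and> Cauchy Y \<and> (\<lambda>n. X n - Y n) \<longlonglongrightarrow> 0"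

quotient_type (overloaded) 'a completion = "nat \<Rightarrow> 'a::real_normed_vector" / partial: completion_rel
proof (rule part_equivpI)
  show "\<exists>X::nat \<Rightarrow> 'a. completion_rel X X"
    by (rule exI[of _ "\<lambda>_. 0"]) (auto simp: completion_rel_def Cauchy_def)
  show "symp (completion_rel :: (nat \<Rightarrow> 'a) \<Rightarrow> _)"
  proof (rule sympI)
    fix X Y :: "nat \<Rightarrow> 'a"
    assume *: "completion_rel X Y"
    hence "(\<lambda>n. - (X n - Y n)) \<longlonglongrightarrow> - 0"
      unfolding completion_rel_def by (intro tendsto_minus) auto
    thus "completion_rel Y X" using * by (simp add: completion_rel_def)
  qed
  show "transp (completion_rel :: (nat \<Rightarrow> 'a) \<Rightarrow> _)"
  proof (rule transpI)
    fix X Y Z :: "nat \<Rightarrow> 'a"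
    assume *: "completion_rel X Y" "completion_rel Y Z"
    hence "(\<lambda>n. (X n - Y n) + (Y n - Z n)) \<longlonglongrightarrow> 0"
      unfolding completion_rel_def by (intro tendsto_add_zero) auto
    thus "completion_rel X Z" using * by (simp add: completion_rel_def)
  qed
qed

lemma Cauchy_unary:
  fixes X :: "nat \<Rightarrow> 'a::real_normed_vector"
  assumes "Cauchy X"
  shows "Cauchy (\<lambda>n. - X n)" "Cauchy (\<lambda>n. a *\<^sub>R X n)" "Cauchy (\<lambda>n. norm (X n))"
proof -
  show "Cauchy (\<lambda>n. - X n)"
    using bounded_linear.Cauchy[OF bounded_linear_minus[OF bounded_linear_ident] assms] by simp
  show "Cauchy (\<lambda>n. a *\<^sub>R X n)"
    by (rule bounded_linear.Cauchy[OF bounded_linear_scaleR_right assms])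
  show "Cauchy (\<lambda>n. norm (X n))"
  proof (rule metric_CauchyI)
    fix e :: real assume "0 < e"
    then obtain M where M: "\<forall>m\<ge>M. \<forall>n\<ge>M. dist (X m) (X n) < e"
      using metric_CauchyD[OF assms] by blast
    show "\<exists>M. \<forall>m\<ge>M. \<forall>n\<ge>M. dist (norm (X m)) (norm (X n)) < e"
      using M norm_triangle_ineq3 by (metis dist_norm dist_real_def order_le_less_trans)
  qed
qed

lemma Cauchy_plus:
  fixes X Y :: "nat \<Rightarrow> 'a::real_normed_vector"
  assumes "Cauchy X" "Cauchy Y"
  shows "Cauchy (\<lambda>n. X n + Y n)"
proof (rule CauchyI)
  fix e :: real assume "0 < e"
  hence e2: "0 < e / 2" by simp
  from CauchyD[OF assms(1) e2] CauchyD[OF assms(2) e2]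
  obtain M M' where M: "\<forall>m\<ge>M. \<forall>n\<ge>M. norm (X m - X n) < e / 2"
      "\<forall>m\<ge>M'. \<forall>n\<ge>M'. norm (Y m - Y n) < e / 2"
    by blast
  have "norm ((X m + Y m) - (X n + Y n)) < e" if "m \<ge> max M M'" "n \<ge> max M M'" for m n
  proof -
    have "norm (X m - X n) < e / 2" "norm (Y m - Y n) < e / 2" using M that by auto
    thus ?thesis using norm_diff_triangle_ineq[of "X m" "Y m" "X n" "Y n"] by linarith
  qed
  thus "\<exists>M. \<forall>m\<ge>M. \<forall>n\<ge>M. norm ((X m + Y m) - (X n + Y n)) < e" by blast
qed

lemma Cauchy_minus:
  fixes X Y :: "nat \<Rightarrow> 'a::real_normed_vector"
  assumes "Cauchy X" "Cauchy Y"
  shows "Cauchy (\<lambda>n. X n - Y n)"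
  using Cauchy_plus[OF assms(1) Cauchy_unary(1)[OF assms(2)]] by simp

lemmas Cauchy_ops = Cauchy_plus Cauchy_minus Cauchy_unary

instantiation completion :: (real_normed_vector) real_vector
begin

lift_definition zero_completion :: "'a completion" is "\<lambda>_. 0"
  by (auto simp: completion_rel_def Cauchy_def)

lift_definition plus_completion :: "'a completion \<Rightarrow> 'a completion \<Rightarrow> 'a completion"
  is "\<lambda>X Y n. X n + Y n"
  by (auto simp: completion_rel_def Cauchy_ops add_diff_add intro: tendsto_add_zero)

lift_definition minus_completion :: "'a completion \<Rightarrow> 'a completion \<Rightarrow> 'a completion"
  is "\<lambda>X Y n. X n - Y n"
proof -
  fix X X' Y Y' :: "nat \<Rightarrow> 'a"
  assume *: "completion_rel X X'" "completion_rel Y Y'"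
  hence "(\<lambda>n. (X n - X' n) - (Y n - Y' n)) \<longlonglongrightarrow> 0 - 0"
    unfolding completion_rel_def by (intro tendsto_diff) auto
  thus "completion_rel (\<lambda>n. X n - Y n) (\<lambda>n. X' n - Y' n)"
    using * by (simp add: completion_rel_def Cauchy_ops algebra_simps)
qed

lift_definition uminus_completion :: "'a completion \<Rightarrow> 'a completion" is "\<lambda>X n. - X n"
proof -
  fix X Y :: "nat \<Rightarrow> 'a"
  assume *: "completion_rel X Y"
  hence "(\<lambda>n. - (X n - Y n)) \<longlonglongrightarrow> - 0"
    unfolding completion_rel_def by (intro tendsto_minus) auto
  thus "completion_rel (\<lambda>n. - X n) (\<lambda>n. - Y n)"
    using * by (simp add: completion_rel_def Cauchy_ops algebra_simps)
qed

lift_definition scaleR_completion :: "real \<Rightarrow> 'a completion \<Rightarrow> 'a completion"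
  is "\<lambda>a X n. a *\<^sub>R X n"
  by (auto simp: completion_rel_def Cauchy_ops scaleR_diff_right[symmetric]
      intro: tendsto_scaleR[OF tendsto_const, where b = 0, simplified])

instance
proof
  fix x y z :: "'a completion" and a b :: real
  show "x + y + z = x + (y + z)"
    by transfer (auto simp: completion_rel_def Cauchy_ops algebra_simps)
  show "x + y = y + x"
    by transfer (auto simp: completion_rel_def Cauchy_ops algebra_simps)
  show "0 + x = x" by transfer (auto simp: completion_rel_def)
  show "- x + x = 0" by transfer (auto simp: completion_rel_def Cauchy_def)
  show "x - y = x + - y"
    by transfer (auto simp: completion_rel_def Cauchy_ops algebra_simps)
  show "a *\<^sub>R (x + y) = a *\<^sub>R x + a *\<^sub>R y"
    by transfer (auto simp: completion_rel_def Cauchy_ops algebra_simps)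
  show "(a + b) *\<^sub>R x = a *\<^sub>R x + b *\<^sub>R x"
    by transfer (auto simp: completion_rel_def Cauchy_ops algebra_simps)
  show "a *\<^sub>R b *\<^sub>R x = (a * b) *\<^sub>R x"
    by transfer (auto simp: completion_rel_def Cauchy_ops)
  show "1 *\<^sub>R x = x" by transfer (auto simp: completion_rel_def)
qed

end

instantiation completion :: (real_normed_vector) real_normed_vector
begin

lift_definition norm_completion :: "'a completion \<Rightarrow> real" is "\<lambda>X. lim (\<lambda>n. norm (X n))"
proof -
  fix X Y :: "nat \<Rightarrow> 'a"
  assume *: "completion_rel X Y"
  hence "convergent (\<lambda>n. norm (X n))"
    by (auto simp: completion_rel_def intro!: Cauchy_convergent Cauchy_ops)
  then obtain L where L: "(\<lambda>n. norm (X n)) \<longlonglongrightarrow> L" by (auto simp: convergent_def)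
  have "(\<lambda>n. norm (X n) - norm (Y n)) \<longlonglongrightarrow> 0"
  proof (rule Lim_null_comparison)
    show "(\<lambda>n. norm (X n - Y n)) \<longlonglongrightarrow> 0"
      using * by (auto simp: completion_rel_def intro: tendsto_norm_zero)
    show "\<forall>\<^sub>F n in sequentially. norm (norm (X n) - norm (Y n)) \<le> norm (X n - Y n)"
      by (auto simp: norm_triangle_ineq3)
  qed
  from tendsto_diff[OF L this] have "(\<lambda>n. norm (Y n)) \<longlonglongrightarrow> L" by simp
  with L show "lim (\<lambda>n. norm (X n)) = lim (\<lambda>n. norm (Y n))" by (simp add: limI)
qed

definition sgn_completion :: "'a completion \<Rightarrow> 'a completion"
  where "sgn_completion x = x /\<^sub>R norm x"
definition dist_completion :: "'a completion \<Rightarrow> 'a completion \<Rightarrow> real"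
  where "dist_completion x y = norm (x - y)"
definition uniformity_completion :: "('a completion \<times> 'a completion) filter"
  where "uniformity_completion = (INF e\<in>{0<..}. principal {(x, y). dist x y < e})"
definition open_completion :: "'a completion set \<Rightarrow> bool"
  where "open_completion U \<longleftrightarrow> (\<forall>x\<in>U. eventually (\<lambda>(x', y). x' = x \<longrightarrow> y \<in> U) uniformity)"

lemma completion_norm_tendsto:
  fixes X :: "nat \<Rightarrow> 'a::real_normed_vector"
  assumes "Cauchy X"
  shows "(\<lambda>n. norm (X n)) \<longlonglongrightarrow> lim (\<lambda>n. norm (X n))"
  using assms by (simp add: Cauchy_ops Cauchy_convergent convergent_LIMSEQ_iff[symmetric])

instance
proof
  fix x y :: "'a completion" and a :: real
  show "sgn x = x /\<^sub>R norm x" by (rule sgn_completion_def)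
  show "dist x y = norm (x - y)" by (rule dist_completion_def)
  show "uniformity = (INF e\<in>{0<..}. principal {(x, y). dist (x::'a completion) y < e})"
    by (rule uniformity_completion_def)
  show "open U \<longleftrightarrow> (\<forall>x\<in>U. \<forall>\<^sub>F (x', y) in uniformity. x' = x \<longrightarrow> y \<in> U)"
    for U :: "'a completion set" by (rule open_completion_def)
  show "norm x = 0 \<longleftrightarrow> x = 0"
  proof transfer
    fix X :: "nat \<Rightarrow> 'a"
    assume "completion_rel X X"
    hence X: "Cauchy X" by (simp add: completion_rel_def)
    have "completion_rel X (\<lambda>_. 0) \<longleftrightarrow> X \<longlonglongrightarrow> 0"
      using X by (simp add: completion_rel_def Cauchy_def)
    also have "\<dots> \<longleftrightarrow> (\<lambda>n. norm (X n)) \<longlonglongrightarrow> 0" by (simp add: tendsto_norm_zero_iff)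
    also have "\<dots> \<longleftrightarrow> lim (\<lambda>n. norm (X n)) = 0"
      using completion_norm_tendsto[OF X] LIMSEQ_unique by metis
    finally show "(lim (\<lambda>n. norm (X n)) = 0) = completion_rel X (\<lambda>_. 0)" by simp
  qed
  show "norm (x + y) \<le> norm x + norm y"
  proof transfer
    fix X Y :: "nat \<Rightarrow> 'a"
    assume "completion_rel X X" "completion_rel Y Y"
    hence X: "Cauchy X" "Cauchy Y" by (simp_all add: completion_rel_def)
    show "lim (\<lambda>n. norm (X n + Y n)) \<le> lim (\<lambda>n. norm (X n)) + lim (\<lambda>n. norm (Y n))"
      by (rule LIMSEQ_le[OF completion_norm_tendsto tendsto_add[OF completion_norm_tendsto
            completion_norm_tendsto]]) (auto simp: X Cauchy_ops norm_triangle_ineq)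
  qed
  show "norm (a *\<^sub>R x) = \<bar>a\<bar> * norm x"
  proof transfer
    fix a :: real and X :: "nat \<Rightarrow> 'a"
    assume "completion_rel X X"
    hence X: "Cauchy X" by (simp add: completion_rel_def)
    show "lim (\<lambda>n. norm (a *\<^sub>R X n)) = \<bar>a\<bar> * lim (\<lambda>n. norm (X n))"
      by (intro limI) (simp add: tendsto_mult_left completion_norm_tendsto[OF X])
  qed
qed

end

lift_definition to_completion :: "'a::real_normed_vector \<Rightarrow> 'a completion" is "\<lambda>x _. x"
  by (auto simp: completion_rel_def Cauchy_def)

lemma norm_to_completion [simp]: "norm (to_completion x) = norm x"
  by transfer (simp add: limI)

lemma to_completion_linear:
  "to_completion (x + y) = to_completion x + to_completion y"
  "to_completion (x - y) = to_completion x - to_completion y"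
  "to_completion (a *\<^sub>R x) = a *\<^sub>R to_completion x" "to_completion 0 = 0"
  by (transfer; simp add: completion_rel_def Cauchy_def)+

lemma to_completion_sum: "to_completion (\<Sum>a\<in>A. f a) = (\<Sum>a\<in>A. to_completion (f a))"
  by (induction A rule: infinite_finite_induct) (auto simp: to_completion_linear)

lemma bounded_linear_to_completion: "bounded_linear to_completion"
  by (rule bounded_linear_intro[of _ 1]) (auto simp: to_completion_linear)

lemma to_completion_tendsto:
  fixes X :: "nat \<Rightarrow> 'a::real_normed_vector"
  assumes X: "Cauchy X"
  shows "(\<lambda>n. to_completion (X n)) \<longlonglongrightarrow> abs_completion X"
proof (rule LIMSEQ_I)
  define x where "x = abs_completion X"
  have XX: "completion_rel X X" using X by (simp add: completion_rel_def)
  have const: "Cauchy (\<lambda>_::nat. X m)" for m by (simp add: Cauchy_def)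
  have eq: "norm (to_completion (X m) - x) = lim (\<lambda>n. norm (X m - X n))" for m
  proof -
    have c: "completion_rel (\<lambda>_. X m) (\<lambda>_. X m)" by (auto simp: completion_rel_def const)
    have "completion_rel (\<lambda>n. X m - X n) (\<lambda>n. X m - X n)"
      using X const by (auto simp: completion_rel_def Cauchy_ops)
    thus ?thesis
      unfolding x_def to_completion.abs_eq using XX c
      by (simp add: minus_completion.abs_eq norm_completion.abs_eq)
  qed
  fix e :: real assume e: "0 < e"
  then obtain M where M: "\<forall>m\<ge>M. \<forall>n\<ge>M. norm (X m - X n) < e / 2"
    using CauchyD[OF X half_gt_zero] by blast
  have "lim (\<lambda>n. norm (X m - X n)) \<le> e / 2" if "m \<ge> M" for m
  proof (rule LIMSEQ_le_const2)
    show "(\<lambda>n. norm (X m - X n)) \<longlonglongrightarrow> lim (\<lambda>n. norm (X m - X n))"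
      by (intro completion_norm_tendsto Cauchy_ops X const)
    show "\<exists>N. \<forall>n\<ge>N. norm (X m - X n) \<le> e / 2" using M that by (meson less_imp_le)
  qed
  moreover have "e / 2 < e" using e by simp
  ultimately show "\<exists>M. \<forall>m\<ge>M. norm (to_completion (X m) - abs_completion X) < e"
    unfolding x_def[symmetric] eq by (meson order_le_less_trans)
qed

lemma completion_limit:
  fixes x :: "'a::real_normed_vector completion"
  obtains X where "Cauchy X" "(\<lambda>n. to_completion (X n)) \<longlonglongrightarrow> x"
proof -
  obtain X where "completion_rel X X" "x = abs_completion X"
    by (induction x rule: completion.abs_induct) blast
  with that to_completion_tendsto show thesis by (auto simp: completion_rel_def)
qed

instance completion :: (real_normed_vector) banach
proof
  fix Z :: "nat \<Rightarrow> 'a completion"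
  assume Z: "Cauchy Z"
  have "\<exists>x. norm (Z n - to_completion x) < 1 / Suc n" for n
  proof -
    obtain X where "(\<lambda>m. to_completion (X m)) \<longlonglongrightarrow> Z n" using completion_limit by blast
    from LIMSEQ_D[OF this, of "1 / Suc n"] obtain m where "norm (to_completion (X m) - Z n) < 1 / Suc n"
      by auto
    thus ?thesis by (subst norm_minus_commute) blast
  qed
  then obtain x where x: "\<And>n. norm (Z n - to_completion (x n)) < 1 / Suc n" by metis
  have null: "(\<lambda>n. Z n - to_completion (x n)) \<longlonglongrightarrow> 0"
    by (rule Lim_null_comparison[OF _ lim_1_over_n[THEN LIMSEQ_Suc]])
      (use x in \<open>auto intro: always_eventually less_imp_le\<close>)
  hence "Cauchy (\<lambda>n. Z n - (Z n - to_completion (x n)))"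
    by (intro Cauchy_ops Z LIMSEQ_imp_Cauchy)
  hence C: "Cauchy (\<lambda>n. to_completion (x n))" by simp
  have "Cauchy x"
    using C by (simp add: Cauchy_def dist_norm to_completion_linear(2)[symmetric])
  from tendsto_add[OF null to_completion_tendsto[OF this]] show "convergent Z" by (auto simp: convergent_def)
qed


section \<open>The space \<open>T\<close> and its positive vectors\<close>

type_synonym tsirelson = "c00 completion"

definition basis_vec :: "nat \<Rightarrow> tsirelson"
  where "basis_vec i = to_completion (unit_vec i)"

definition is_expansion :: "(nat \<Rightarrow> real) \<Rightarrow> tsirelson \<Rightarrow> bool"
  where "is_expansion a x \<longleftrightarrow> a 0 = 0 \<and> (\<lambda>i. a (Suc i) *\<^sub>R basis_vec (Suc i)) sums x"

definition coord :: "tsirelson \<Rightarrow> nat \<Rightarrow> real"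
  where "coord x = (THE a. is_expansion a x)"

definition positive_vec :: "tsirelson \<Rightarrow> bool"
  where "positive_vec x \<longleftrightarrow> (\<forall>i\<ge>1. 0 \<le> coord x i)"


subsection \<open>The unit vectors form a basis\<close>

lemma norm_c00_eq:
  "norm x = max (c0_norm x) (1 / 2 * Sup (adm_sums norm x))" for x :: c00
  using is_tsirelson_norm by (simp add: is_tsirelson_norm_def norm_c00_def)

lemma entry_le_norm: "\<bar>entry x i\<bar> \<le> norm x"
  using entry_le_c0_norm[of x i] norm_c00_eq[of x] by linarith

lemma is_seminorm_norm: "is_seminorm norm"
  by (simp add: is_seminorm_def norm_triangle_ineq)

lemma proj_proj: "proj E (proj F x) = proj (E \<inter> F) x"
  by (rule c00_eqI) auto

lemma norm_proj_le: "norm (proj F x) \<le> norm x"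
proof (induction "card (supp x)" arbitrary: x rule: less_induct)
  case less
  show ?case
  proof (cases "supp x \<subseteq> F")
    case True
    hence "proj F x = x" by (intro c00_eqI) (auto simp: supp_def)
    thus ?thesis by simp
  next
    case nsub: False
    define y where "y = proj F x"
    have "Sup (adm_sums norm y) \<le> max (Sup (adm_sums norm x)) (norm y)"
    proof (rule Sup_adm_sums_leI)
      fix k E assume E: "admissible k E"
      show "(\<Sum>j=1..k. norm (proj (E j) y)) \<le> max (Sup (adm_sums norm x)) (norm y)"
      proof (cases "\<exists>l\<in>{1..k}. supp x \<subseteq> E l")
        case True
        then obtain l where l: "l \<in> {1..k}" "supp x \<subseteq> E l" by blast
        have "norm (proj (E j) y) = (if j = l then norm y else 0)" if "j \<in> {1..k}" for j
        proof (cases "j = l")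
          case True
          have "proj (E l) y = y"
            by (rule c00_eqI) (use l in \<open>auto simp: supp_def y_def\<close>)
          thus ?thesis using True by simp
        next
          case False
          hence "proj (E j) y = 0"
            by (intro c00_eqI)
              (use l admissible_disjoint[OF E that l(1)] in \<open>auto simp: supp_def y_def\<close>)
          thus ?thesis using False by simp
        qed
        hence "(\<Sum>j=1..k. norm (proj (E j) y)) = (\<Sum>j=1..k. if j = l then norm y else 0)"
        by (intro sum.cong refl)
      hence "(\<Sum>j=1..k. norm (proj (E j) y)) = norm y" using l(1) by simp
        thus ?thesis by simp
      next
        case False
        have "(\<Sum>j=1..k. norm (proj (E j) y)) \<le> (\<Sum>j=1..k. norm (proj (E j) x))"
        proof (rule sum_mono)
          fix j assume "j \<in> {1..k}"
          hence "supp (proj (E j) x) \<subset> supp x"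
            using False by (auto simp: supp_def split: if_splits)
          hence "norm (proj F (proj (E j) x)) \<le> norm (proj (E j) x)"
            by (intro less psubset_card_mono) auto
          thus "norm (proj (E j) y) \<le> norm (proj (E j) x)"
            by (simp add: y_def proj_proj Int_commute)
        qed
        also have "\<dots> \<le> Sup (adm_sums norm x)" by (rule adm_sum_le_Sup[OF is_seminorm_norm E])
        finally show ?thesis by simp
      qed
    qed
    moreover have "c0_norm y \<le> c0_norm x"
      by (rule c0_norm_leI) (auto simp: y_def entry_le_c0_norm c0_norm_nonneg)
    ultimately have "norm y \<le> norm x"
      using norm_c00_eq[of x] norm_c00_eq[of y] norm_ge_zero[of x] norm_ge_zero[of y]
      by linarith
    thus ?thesis by (simp add: y_def)
  qed
qed

lemma proj_atMost_expansion: "proj {..n} x = (\<Sum>i<n. entry x (Suc i) *\<^sub>R unit_vec (Suc i))"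
proof (rule c00_eqI)
  fix i
  show "entry (proj {..n} x) i = entry (\<Sum>i<n. entry x (Suc i) *\<^sub>R unit_vec (Suc i)) i"
  proof (cases i)
    case 0
    thus ?thesis by simp
  next
    case (Suc j)
    have "(\<Sum>a<n. entry x (Suc a) * (if a = j then 1 else 0)) =
        (\<Sum>a<n. if a = j then entry x (Suc a) else 0)"
      by (rule sum.cong) auto
    thus ?thesis using Suc by (simp add: entry_sum Suc_le_eq)
  qed
qed

lemma ex_expansion: "\<exists>a. is_expansion a x"
proof -
  obtain X where X: "Cauchy X" "(\<lambda>n. to_completion (X n)) \<longlonglongrightarrow> x" using completion_limit by blast
  have "convergent (\<lambda>n. entry (X n) i)" for i
  proof (rule Cauchy_convergent, rule CauchyI)
    fix e :: real assume "0 < e"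
    from CauchyD[OF X(1) this] obtain M where "\<forall>m\<ge>M. \<forall>n\<ge>M. norm (X m - X n) < e" by blast
    thus "\<exists>M. \<forall>m\<ge>M. \<forall>n\<ge>M. norm (entry (X m) i - entry (X n) i) < e"
      using entry_le_norm[of "X _ - X _" i] by (metis entry_simps(3) order_le_less_trans real_norm_def)
  qed
  then obtain a where a: "\<And>i. (\<lambda>n. entry (X n) i) \<longlonglongrightarrow> a i" unfolding convergent_def by metis
  have a0: "a 0 = 0" using a[of 0] by (simp add: LIMSEQ_const_iff)
  define S where "S n = (\<Sum>i<n. a (Suc i) *\<^sub>R unit_vec (Suc i))" for n
  have S: "(\<lambda>m. proj {..n} (X m)) \<longlonglongrightarrow> S n" for n
    unfolding proj_atMost_expansion S_def by (intro tendsto_intros a)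
  have "(\<lambda>n. to_completion (S n)) \<longlonglongrightarrow> x"
  proof (rule LIMSEQ_I)
    fix r :: real assume r: "0 < r"
    obtain M where M: "\<forall>m\<ge>M. \<forall>n\<ge>M. norm (X m - X n) < r / 4"
      using CauchyD[OF X(1), of "r / 4"] r by auto
    obtain M' where M': "\<forall>m\<ge>M'. norm (to_completion (X m) - x) < r / 4"
      using LIMSEQ_D[OF X(2), of "r / 4"] r by auto
    define m where "m = max M M'"
    have "norm (to_completion (S n) - x) < r" if n: "n \<ge> Max (insert 0 (supp (X m)))" for n
    proof -
      have "i \<le> n" if "i \<in> supp (X m)" for i
        using n that by (meson Max_ge finite.insertI finite_supp insertCI order_trans)
      hence pm: "proj {..n} (X m) = X m" by (intro c00_eqI) (auto simp: supp_def)
      have "norm (S n - X m) \<le> r / 4"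
      proof (rule LIMSEQ_le_const2)
        show "(\<lambda>l. norm (proj {..n} (X l) - X m)) \<longlonglongrightarrow> norm (S n - X m)"
          by (intro tendsto_intros S)
        show "\<exists>N. \<forall>l\<ge>N. norm (proj {..n} (X l) - X m) \<le> r / 4"
        proof (intro exI allI impI)
          fix l assume "M \<le> l"
          have "norm (proj {..n} (X l) - X m) = norm (proj {..n} (X l - X m))"
            by (simp add: proj_linear pm)
          also have "\<dots> \<le> norm (X l - X m)" by (rule norm_proj_le)
          also have "\<dots> \<le> r / 4" using M \<open>M \<le> l\<close> by (simp add: m_def less_imp_le)
          finally show "norm (proj {..n} (X l) - X m) \<le> r / 4" .
        qed
      qed
      moreover have "norm (to_completion (S n) - x) \<le> norm (to_completion (S n - X m)) + norm (to_completion (X m) - x)"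
        unfolding to_completion_linear by (rule norm_diff_triangle_le[OF order_refl order_refl])
      moreover have "norm (to_completion (X m) - x) < r / 4" using M' by (simp add: m_def)
      ultimately show ?thesis using r by simp
    qed
    thus "\<exists>no. \<forall>n\<ge>no. norm (to_completion (S n) - x) < r" by blast
  qed
  hence "is_expansion a x"
    by (simp add: is_expansion_def a0 sums_def S_def to_completion_sum to_completion_linear basis_vec_def)
  thus ?thesis by blast
qed

theorem ex1_expansion: "\<exists>!a. is_expansion a x"
proof (rule ex_ex1I[OF ex_expansion])
  fix a b assume ab: "is_expansion a x" "is_expansion b x"
  define c where "c i = a i - b i" for i
  have "(\<lambda>i. c (Suc i) *\<^sub>R basis_vec (Suc i)) sums 0"
    using sums_diff[of _ x _ x] ab by (force simp: is_expansion_def c_def scaleR_left_diff_distrib)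
  hence lim: "(\<lambda>n. to_completion (\<Sum>i<n. c (Suc i) *\<^sub>R unit_vec (Suc i))) \<longlonglongrightarrow> 0"
    by (simp add: sums_def to_completion_sum to_completion_linear basis_vec_def)
  have "c (Suc j) = 0" for j
  proof -
    have "\<bar>c (Suc j)\<bar> \<le> norm (to_completion (\<Sum>i<n. c (Suc i) *\<^sub>R unit_vec (Suc i)))" if "n > j" for n
    proof -
      have "entry (\<Sum>i<n. c (Suc i) *\<^sub>R unit_vec (Suc i)) (Suc j) =
          (\<Sum>i<n. if i = j then c (Suc i) else 0)"
        unfolding entry_sum by (rule sum.cong) auto
      also have "\<dots> = c (Suc j)" using that by simp
      finally show ?thesis using entry_le_norm by (metis norm_to_completion)
    qed
    hence "\<bar>c (Suc j)\<bar> \<le> norm (0 :: tsirelson)"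
      by (intro LIMSEQ_le_const[OF tendsto_norm[OF lim]] exI[of _ "Suc j"]) (auto simp: Suc_le_eq)
    thus ?thesis by simp
  qed
  moreover have "a 0 = b 0" using ab by (simp add: is_expansion_def)
  ultimately show "a = b"
    by (metis c_def eq_iff_diff_eq_0 ext not0_implies_Suc)
qed

lemma is_expansion_coord: "is_expansion (coord x) x"
  unfolding coord_def by (rule theI'[OF ex1_expansion])

end

theory Submission
  imports Defs
begin

text \<open>Up to a power of two \<open>p \<ge> 2 n\<close> the coordinates form \<open>O(log n)\<close> dyadic blocks, and on each of
  them the norm is 2-equivalent to the \<open>\<ell>\<^sub>1\<close>-norm, which is additive on positive vectors; this
  is where the logarithm is lost. Beyond \<open>p\<close>, \<open>n\<close> positive vectors satisfy a lower
  \<open>\<ell>\<^sub>1\<close>-estimate with a constant independent of \<open>n\<close>, as for disjoint vectors in the modified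
  Tsirelson space (Casazza and Odell).\<close>


section \<open>Lower estimates for successive sets\<close>

text \<open>Uniqueness of the Tsirelson norm identifies it with the limit of the iterates, so
  estimates can be proved by induction on the level.\<close>

lemma norm_eq_norm_lim: "norm x = norm_lim x" for x :: c00
  using ex1_tsirelson_norm is_tsirelson_norm is_tsirelson_norm_lim
  unfolding norm_c00_def by metis

text \<open>Listed in increasing order, at most \<open>p\<close> successive sets beyond
  \<open>p\<close> form an admissible family, and one use of the norm equation costs the factor 2.
  It is applied to singletons, to dyadic blocks, and to heads and tails of intervals.\<close>

lemma sum_norm_proj_successive_le:
  fixes W :: "nat set" and x :: c00
  assumes W: "finite W" "card W \<le> p"
    and gt: "\<And>w. w \<in> W \<Longrightarrow> G w \<subseteq> {p<..}"
    and succ: "\<And>w w' a b. \<lbrakk>w \<in> W; w' \<in> W; w < w'; a \<in> G w; b \<in> G w'\<rbrakk> \<Longrightarrow> a < b"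
  shows "(\<Sum>w\<in>W. norm (proj (G w) x)) \<le> 2 * norm x"
proof (cases "W = {}")
  case False
  define k where "k = card W"
  have k: "1 \<le> k" "k \<le> p" using False W by (auto simp: k_def Suc_le_eq card_gt_0_iff)
  obtain h where h: "bij_betw h {..<k} W" "strict_mono_on {..<k} h"
    using ex_bij_betw_strict_mono_card[OF W(1)] unfolding k_def by blast
  \<comment> \<open>Intersecting with the support makes the sets finite, as admissibility demands,
    without changing the projections of \<open>x\<close>. The shift is needed because admissible
    families are numbered from 1.\<close>
  define E where "E j = G (h (j - 1)) \<inter> supp x" for j
  have hW: "h (j - 1) \<in> W" if "j \<in> {1..k}" for j
    using that h(1) by (auto simp: bij_betw_def)
  have "set_less (E i) (E j)" if "i \<in> {1..k}" "j \<in> {1..k}" "i < j" for i j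
  proof -
    have "h (i - 1) < h (j - 1)" using strict_mono_onD[OF h(2), of "i - 1" "j - 1"] that by auto
    hence "\<forall>a\<in>E i. \<forall>b\<in>E j. a < b"
      using succ[OF hW[OF that(1)] hW[OF that(2)]] by (simp add: E_def)
    moreover have "finite (E i)" "finite (E j)" by (simp_all add: E_def)
    ultimately show ?thesis unfolding set_less_def by (meson Max_in Min_in)
  qed
  moreover have "finite (E j)" "set_less {k} (E j)" if "j \<in> {1..k}" for j
  proof -
    show fin: "finite (E j)" by (simp add: E_def)
    have "\<forall>a\<in>E j. k < a" using gt[OF hW[OF that]] k(2) by (auto simp: E_def)
    thus "set_less {k} (E j)" using Min_in[OF fin] by (cases "E j = {}") (auto simp: set_less_def)
  qed
  ultimately have E: "admissible k E" using k by (auto simp: admissible_def)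
  have EG: "proj (E j) x = proj (G (h (j - 1))) x" for j
    by (rule c00_eqI) (auto simp: E_def supp_def)
  have "(\<Sum>w\<in>W. norm (proj (G w) x)) = (\<Sum>j<k. norm (proj (G (h j)) x))"
    by (rule sum.reindex_bij_betw[OF h(1), symmetric])
  also have "\<dots> = (\<Sum>j=1..k. norm (proj (E j) x))"
    unfolding EG by (rule sum.reindex_bij_witness[of _ "\<lambda>j. j - 1" Suc]) auto
  also have "\<dots> \<le> Sup (adm_sums norm x)" by (rule adm_sum_le_Sup[OF is_seminorm_norm E])
  also have "\<dots> \<le> 2 * norm x" using norm_c00_eq[of x] by linarith
  finally show ?thesis .
qed simp

text \<open>The singletons of \<open>H\<close> are at most \<open>q\<close> successive sets beyond
  \<open>q\<close>, and the norm of each piece dominates the modulus of its entry.\<close>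

lemma sum_abs_entry_dyadic_le:
  assumes "H \<subseteq> {q<..2*q}"
  shows "(\<Sum>a\<in>H. \<bar>entry x a\<bar>) \<le> 2 * norm (proj H x)"
proof -
  have fin: "finite H" using assms finite_subset by blast
  have "(\<Sum>a\<in>H. \<bar>entry x a\<bar>) \<le> (\<Sum>a\<in>H. norm (proj {a} (proj H x)))"
  proof (rule sum_mono)
    fix a assume "a \<in> H"
    thus "\<bar>entry x a\<bar> \<le> norm (proj {a} (proj H x))"
      using entry_le_norm[of "proj {a} (proj H x)" a] by simp
  qed
  also have "\<dots> \<le> 2 * norm (proj H x)"
    using card_mono[OF _ assms] assms fin
    by (intro sum_norm_proj_successive_le[where p = q]) auto
  finally show ?thesis .
qed

text \<open>There are only \<open>q\<close> dyadic blocks in this range, so one further level of the norm suffices.\<close>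

lemma sum_abs_entry_exp_le:
  assumes "H \<subseteq> {q<..2^q*q}"
  shows "(\<Sum>a\<in>H. \<bar>entry x a\<bar>) \<le> 4 * norm (proj H x)"
proof -
  have fin: "finite H" using assms finite_subset by blast
  define D where "D j = H \<inter> {2^j*q<..2^Suc j*q}" for j
  have lt: "a < b" if "i < j" "a \<in> D i" "b \<in> D j" for i j a b
  proof -
    have "a \<le> 2^Suc i*q" "2^j*q < b" using that by (auto simp: D_def)
    moreover have "(2::nat)^Suc i*q \<le> 2^j*q" using that by (intro mult_right_mono power_increasing) auto
    ultimately show ?thesis by linarith
  qed
  \<comment> \<open>Peeling off one block at a time leaves a remainder beyond \<open>2^n*q\<close>,
    which misses \<open>H\<close> once \<open>n = q\<close>.\<close>
  have "H \<subseteq> (\<Union>j<n. D j) \<union> {2^n*q<..}" for n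
  proof (induction n)
    case 0
    show ?case using assms by auto
  next
    case (Suc n)
    have "H \<inter> {2^n*q<..} \<subseteq> D n \<union> {2^Suc n*q<..}" by (auto simp: D_def)
    thus ?case using Suc by (auto simp: lessThan_Suc)
  qed
  from this[of q] have "H = (\<Union>j<q. D j)" using assms unfolding D_def by fastforce
  moreover have "D i \<inter> D j = {}" if "i \<noteq> j" for i j
    using lt[of i j] lt[of j i] that by (meson disjoint_iff less_irrefl nat_neq_iff)
  moreover have "finite (D j)" for j using fin by (simp add: D_def)
  ultimately have "(\<Sum>a\<in>H. \<bar>entry x a\<bar>) = (\<Sum>j<q. \<Sum>a\<in>D j. \<bar>entry x a\<bar>)"
    using sum.UNION_disjoint[of "{..<q}" D "\<lambda>a. \<bar>entry x a\<bar>"] by simp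
  also have "\<dots> \<le> (\<Sum>j<q. 2 * norm (proj (D j) (proj H x)))"
  proof (rule sum_mono)
    fix j
    have "proj (D j) (proj H x) = proj (D j) x" by (rule c00_eqI) (auto simp: D_def)
    thus "(\<Sum>a\<in>D j. \<bar>entry x a\<bar>) \<le> 2 * norm (proj (D j) (proj H x))"
      using sum_abs_entry_dyadic_le[of "D j" "2^j*q" x] by (auto simp: D_def mult.assoc)
  qed
  also have "\<dots> = 2 * (\<Sum>j<q. norm (proj (D j) (proj H x)))" by (simp add: sum_distrib_left)
  also have "(\<Sum>j<q. norm (proj (D j) (proj H x))) \<le> 2 * norm (proj H x)"
  proof (rule sum_norm_proj_successive_le)
    show "D j \<subseteq> {q<..}" for j using assms by (auto simp: D_def)
  qed (simp_all, rule lt)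
  finally show ?thesis by simp
qed

text \<open>Each doubling of the range adds one dyadic block and costs \<open>2 * norm x\<close>.
  This is the source of the logarithm.\<close>

lemma sum_abs_entry_initial_le: "(\<Sum>a\<in>{1..2^l}. \<bar>entry x a\<bar>) \<le> (1 + 2 * real l) * norm x"
proof (induction l)
  case 0
  show ?case using entry_le_norm[of x 1] by simp
next
  case (Suc l)
  have "{1..2^Suc l} = {1..2^l} \<union> {2^l<..2*2^l::nat}" by auto
  hence "(\<Sum>a\<in>{1..2^Suc l}. \<bar>entry x a\<bar>) =
      (\<Sum>a\<in>{1..2^l}. \<bar>entry x a\<bar>) + (\<Sum>a\<in>{2^l<..2*2^l}. \<bar>entry x a\<bar>)"
    by (simp only:) (rule sum.union_disjoint; auto)
  moreover have "(\<Sum>a\<in>{2^l<..2*2^l}. \<bar>entry x a\<bar>) \<le> 2 * norm x"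
    using sum_abs_entry_dyadic_le[of "{2^l<..2*2^l}" "2^l" x] norm_proj_le[of "{2^l<..2*2^l}" x]
    by simp
  ultimately show ?case using Suc by (simp add: algebra_simps)
qed


section \<open>Upper estimates\<close>

lemma seminorm_proj_le_sum:
  assumes N: "is_seminorm N" and Z: "finite Z"
    and cover: "F \<inter> supp x \<subseteq> (\<Union>z\<in>Z. G z)"
    and disj: "disjoint_family_on G Z"
  shows "N (proj F x) \<le> (\<Sum>z\<in>Z. N (proj (F \<inter> G z) x))"
proof -
  have "proj F x = (\<Sum>z\<in>Z. proj (F \<inter> G z) x)"
  proof (rule c00_eqI)
    fix a
    show "entry (proj F x) a = entry (\<Sum>z\<in>Z. proj (F \<inter> G z) x) a"
    proof (cases "a \<in> F \<inter> supp x")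
      case True
      then obtain z where z: "z \<in> Z" "a \<in> G z" using cover by blast
      have "(\<Sum>w\<in>Z. entry (proj (F \<inter> G w) x) a) = (\<Sum>w\<in>Z. if w = z then entry x a else 0)"
        using True z disj by (intro sum.cong) (auto simp: disjoint_family_on_def)
      thus ?thesis using True z Z by (simp add: entry_sum)
    next
      case False
      hence "entry (proj (F \<inter> G w) x) a = 0" for w by (auto simp: supp_def)
      thus ?thesis using False unfolding entry_sum by (auto simp: supp_def)
    qed
  qed
  thus ?thesis using is_seminorm_sum[OF N] by metis
qed

text \<open>Prepending the zero function to \<open>norm_iter\<close> makes the base case of the induction below trivial.\<close>

primrec trunc_norm :: "nat \<Rightarrow> c00 \<Rightarrow> real" where
  "trunc_norm 0 = (\<lambda>_. 0)"
| "trunc_norm (Suc n) = norm_iter n"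

lemma is_seminorm_trunc: "is_seminorm (trunc_norm n)"
  by (cases n) (simp_all add: is_seminorm_iter, simp add: is_seminorm_def)

lemma trunc_norm_le_l1: "trunc_norm n x \<le> (\<Sum>i\<in>supp x. \<bar>entry x i\<bar>)"
  by (cases n) (simp_all add: norm_iter_le_l1 sum_nonneg)

text \<open>At level 0 all admissible sums vanish and only the supremum norm remains, so the
  recursion holds from the first step on.\<close>

lemma trunc_norm_Suc:
  "trunc_norm (Suc n) x = max (c0_norm x) (1 / 2 * Sup (adm_sums (trunc_norm n) x))"
proof (cases n)
  case 0
  have "adm_sums (\<lambda>_. 0) x = {0}" using admissible_empty by (auto simp: adm_sums_def)
  thus ?thesis using 0 c0_norm_nonneg[of x] by simp
qed simp

lemma trunc_norm_proj_le_l1: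
  assumes "finite F"
  shows "trunc_norm n (proj F x) \<le> (\<Sum>a\<in>F. \<bar>entry x a\<bar>)"
proof -
  have "trunc_norm n (proj F x) \<le> (\<Sum>a\<in>supp (proj F x). \<bar>entry (proj F x) a\<bar>)"
    by (rule trunc_norm_le_l1)
  also have "\<dots> \<le> (\<Sum>a\<in>F. \<bar>entry (proj F x) a\<bar>)"
    by (rule sum_mono2) (use assms in \<open>auto simp: supp_def split: if_splits\<close>)
  also have "\<dots> = (\<Sum>a\<in>F. \<bar>entry x a\<bar>)" by (rule sum.cong) auto
  finally show ?thesis .
qed

text \<open>An admissible sum depends only on the traces of its sets on the finite set
  \<open>supp x\<close>. Hence the supremum is attained, which supplies an actual family of
  children.\<close>

lemma finite_adm_sums:
  assumes "N 0 = 0"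
  shows "finite (adm_sums N x)"
proof (rule finite_subset)
  show "adm_sums N x \<subseteq> (\<lambda>P. \<Sum>A\<in>P. N (proj A x)) ` Pow (Pow (supp x))"
  proof
    fix t assume "t \<in> adm_sums N x"
    then obtain k E where E: "admissible k E" and t: "t = (\<Sum>j=1..k. N (proj (E j) x))"
      by (auto simp: adm_sums_def)
    define P where "P = (\<lambda>j. E j \<inter> supp x) ` {1..k}"
    \<comment> \<open>Distinct indices with the same trace have an empty trace by disjointness, so
      nothing is lost by summing over the set of traces.\<close>
    have "N (proj (E i \<inter> supp x) x) = 0"
      if "i \<in> {1..k}" "j \<in> {1..k}" "i \<noteq> j" "E i \<inter> supp x = E j \<inter> supp x" for i j
    proof -
      have "E i \<inter> supp x = {}" using admissible_disjoint[OF E that(1-3)] that(4) by blast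
      hence "proj (E i \<inter> supp x) x = 0" by (intro c00_eqI) simp
      thus ?thesis using assms by simp
    qed
    hence "(\<Sum>A\<in>P. N (proj A x)) = (\<Sum>j=1..k. N (proj (E j \<inter> supp x) x))"
      unfolding P_def by (subst sum.reindex_nontrivial) auto
    moreover have "proj (E j \<inter> supp x) x = proj (E j) x" for j
      by (rule c00_eqI) (auto simp: supp_def)
    ultimately have "t = (\<Sum>A\<in>P. N (proj A x))" by (simp add: t)
    thus "t \<in> (\<lambda>P. \<Sum>A\<in>P. N (proj A x)) ` Pow (Pow (supp x))"
      by (auto simp: P_def)
  qed
qed simp

lemma c0_norm_attained: "\<exists>a. c0_norm x = \<bar>entry x a\<bar>"
proof -
  have "range (\<lambda>i. \<bar>entry x i\<bar>) \<subseteq> insert 0 ((\<lambda>i. \<bar>entry x i\<bar>) ` supp x)"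
    by (auto simp: supp_def)
  hence "finite (range (\<lambda>i. \<bar>entry x i\<bar>))"
    by (rule finite_subset) simp
  hence "c0_norm x \<in> range (\<lambda>i. \<bar>entry x i\<bar>)"
    unfolding c0_norm_def by (subst cSup_eq_Max) (auto intro!: Max_in)
  thus ?thesis by blast
qed

text \<open>The case \<open>k = 0\<close> accounts for the supremum norm, with \<open>m\<close> the position of the largest entry.\<close>

lemma trunc_norm_Suc_le:
  assumes supp: "supp y \<subseteq> {p<..}"
  shows "\<exists>m k E. p < m \<and> k < m \<and> disjoint_family_on E {1..k} \<and>
    (\<forall>s\<in>{1..k}. E s \<inter> supp y \<subseteq> {m..}) \<and>
    trunc_norm (Suc n) y \<le> \<bar>entry y m\<bar> + 1 / 2 * (\<Sum>s=1..k. trunc_norm n (proj (E s) y))"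
proof (cases "c0_norm y \<le> 1 / 2 * Sup (adm_sums (trunc_norm n) y)")
  case True
  have fin: "finite (adm_sums (trunc_norm n) y)"
    by (rule finite_adm_sums) (rule is_seminormD(3)[OF is_seminorm_trunc])
  hence "Sup (adm_sums (trunc_norm n) y) \<in> adm_sums (trunc_norm n) y"
    using adm_sums_nonempty by (simp add: cSup_eq_Max)
  then obtain k E where E: "admissible k E"
    and eq: "Sup (adm_sums (trunc_norm n) y) = (\<Sum>s=1..k. trunc_norm n (proj (E s) y))"
    by (auto simp: adm_sums_def)
  \<comment> \<open>All relevant points lie beyond both \<open>p\<close> and \<open>k\<close>, so
    they start at this \<open>m\<close> or later. The entry at \<open>m\<close> is only non-negative
    slack in this case.\<close>
  define m where "m = Suc (max p k)"
  have "E s \<inter> supp y \<subseteq> {m..}" if "s \<in> {1..k}" for s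
  proof
    fix a assume a: "a \<in> E s \<inter> supp y"
    have Es: "finite (E s)" "set_less {k} (E s)" using E that by (auto simp: admissible_def)
    have "k < Min (E s)" using Es(2) a by (auto simp: set_less_def)
    also have "\<dots> \<le> a" using Es(1) a by simp
    finally have "k < a" .
    moreover have "p < a" using a supp by auto
    ultimately show "a \<in> {m..}" by (simp add: m_def)
  qed
  moreover have "disjoint_family_on E {1..k}"
    using admissible_disjoint[OF E] by (auto simp: disjoint_family_on_def)
  moreover have "trunc_norm (Suc n) y \<le> \<bar>entry y m\<bar> + 1 / 2 * (\<Sum>s=1..k. trunc_norm n (proj (E s) y))"
    unfolding trunc_norm_Suc eq[symmetric] using True by linarith
  moreover have "p < m" "k < m" by (auto simp: m_def)
  ultimately show ?thesis by blast
next
  case False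
  hence eq: "trunc_norm (Suc n) y = c0_norm y" unfolding trunc_norm_Suc by linarith
  obtain a where a: "c0_norm y = \<bar>entry y a\<bar>" using c0_norm_attained by blast
  show ?thesis
  proof (cases "p < a")
    case True
    thus ?thesis using eq a
      by (intro exI[of _ a] exI[of _ 0] exI[of _ "\<lambda>_. {}"]) (auto simp: disjoint_family_on_def)
  next
    case False
    \<comment> \<open>The supremum norm is then 0, and any position beyond \<open>p\<close> serves
      as \<open>m\<close>.\<close>
    hence "entry y a = 0" using supp by (auto simp: supp_def)
    thus ?thesis using eq a
      by (intro exI[of _ "Suc p"] exI[of _ 0] exI[of _ "\<lambda>_. {}"]) (auto simp: disjoint_family_on_def)
  qed
qed


section \<open>Positive vectors supported far out\<close>

text \<open>With \<open>q = z - 1\<close> this places the head \<open>{z..2 * z^2}\<close> in the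
  range of \<open>sum_abs_entry_exp_le\<close>. The inequality fails at \<open>q = 3\<close>, whence
  the requirement \<open>4 \<le> p\<close> below.\<close>

lemma two_Suc_square_le: "4 \<le> q \<Longrightarrow> 2 * (Suc q)^2 \<le> 2 ^ q * q" for q :: nat
proof (induction q rule: dec_induct)
  case base
  show ?case by simp
next
  case (step q)
  have "2 * (Suc (Suc q))^2 \<le> 2 * (2 * (Suc q)^2)"
    using mult_le_mono[OF step.hyps(1) step.hyps(1)] by (simp add: power2_eq_square algebra_simps)
  also have "\<dots> \<le> 2 * (2 ^ q * q)" by (rule mult_le_mono2[OF step.IH])
  also have "\<dots> \<le> 2 ^ Suc q * Suc q" by simp
  finally show ?case .
qed

text \<open>Cutting at the points \<open>m i\<close> from \<open>trunc_norm_Suc_le\<close>, each resulting interval starting at \<open>z\<close>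
  is split at \<open>2 z\<^sup>2\<close>. On the head \<open>{z..2 z\<^sup>2}\<close> the norm is equivalent to the \<open>\<ell>\<^sub>1\<close>-norm. In the tail at
  most \<open>z\<^sup>2\<close> children are active, so the induction hypothesis applies, and they carry the factor \<open>1/2\<close>.
  This factor pays for adding up the norms of the successive heads and tails.\<close>

lemma sum_trunc_norm_le:
  fixes y :: "nat \<Rightarrow> c00"
  assumes "finite I" "2 * card I \<le> p" "4 \<le> p"
    and "\<And>i. i \<in> I \<Longrightarrow> supp (y i) \<subseteq> {p<..}"
    and "\<And>i a. i \<in> I \<Longrightarrow> 0 \<le> entry (y i) a"
    and "\<And>a. (\<Sum>i\<in>I. entry (y i) a) \<le> entry x a"
  shows "(\<Sum>i\<in>I. trunc_norm n (y i)) \<le> 12 * norm x"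
  using assms
proof (induction n arbitrary: I p y x)
  case 0
  show ?case by simp
next
  case (Suc n)
  note I = Suc.prems(1) and p = Suc.prems(2,3) and supp = Suc.prems(4)
    and pos = Suc.prems(5) and le = Suc.prems(6)
  define Q where "Q i m k E \<longleftrightarrow> p < m \<and> k < m \<and> disjoint_family_on E {1..k} \<and>
      (\<forall>s\<in>{1..k}. E s \<inter> supp (y i) \<subseteq> {m..}) \<and>
      trunc_norm (Suc n) (y i) \<le>
        \<bar>entry (y i) m\<bar> + 1 / 2 * (\<Sum>s=1..k. trunc_norm n (proj (E s) (y i)))" for i m k E
  have "\<forall>i\<in>I. \<exists>m k E. Q i m k E"
    unfolding Q_def using trunc_norm_Suc_le[OF supp] by blast
  then obtain m k E where Q: "\<And>i. i \<in> I \<Longrightarrow> Q i (m i) (k i) (E i)" by metis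
  have mp: "p < m i" and km: "k i < m i" and disj: "disjoint_family_on (E i) {1..k i}"
    and bound: "trunc_norm (Suc n) (y i) \<le>
        \<bar>entry (y i) (m i)\<bar> + 1 / 2 * (\<Sum>s=1..k i. trunc_norm n (proj (E i s) (y i)))"
    if "i \<in> I" for i
    using Q[OF that] unfolding Q_def by blast+
  have Em: "E i s \<inter> supp (y i) \<subseteq> {m i..}" if "i \<in> I" "s \<in> {1..k i}" for i s
    using Q[OF that(1)] that(2) unfolding Q_def by blast
  define Z where "Z = m ` I"
  have Z: "finite Z" "2 * card Z \<le> p"
    using I p(1) card_image_le[OF I, of m] by (auto simp: Z_def)
  have Zp: "p < z" if "z \<in> Z" for z
    using that mp by (auto simp: Z_def)
  \<comment> \<open>The interval from \<open>z\<close> up to the next cut point; it is unbounded for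
    the last cut point.\<close>
  define J where "J z = {a. z \<le> a \<and> (\<forall>z'\<in>Z. z < z' \<longrightarrow> a < z')}" for z
  define H where "H z = J z \<inter> {..2 * z^2}" for z
  define T where "T z = J z \<inter> {2 * z^2<..}" for z
  \<comment> \<open>The children of \<open>y i\<close> live on the intervals starting at these cut
    points. For them \<open>k i < m i \<le> z\<close>, which later bounds the number of children
    active at \<open>z\<close>.\<close>
  define R where "R i = {z. z \<in> Z \<and> m i \<le> z}" for i
  have J_lt: "a < b" if "z \<in> Z" "z' \<in> Z" "z < z'" "a \<in> J z" "b \<in> J z'" for z z' a b
    using that by (auto simp: J_def)
  have J_cover: "\<exists>z\<in>R i. a \<in> J z" if "i \<in> I" "m i \<le> a" for i a
  proof -
    \<comment> \<open>The last cut point not exceeding \<open>a\<close>; it is at least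
      \<open>m i\<close> because \<open>m i\<close> itself competes.\<close>
    define z where "z = Max {z \<in> Z. z \<le> a}"
    have fin: "finite {z \<in> Z. z \<le> a}" using Z by simp
    have mi: "m i \<in> {z \<in> Z. z \<le> a}" using that by (auto simp: Z_def)
    hence "z \<in> {z \<in> Z. z \<le> a}" unfolding z_def by (intro Max_in[OF fin]) blast
    moreover have "m i \<le> z" unfolding z_def by (rule Max_ge[OF fin mi])
    moreover have "a < z'" if "z' \<in> Z" "z < z'" for z'
      using that Max_ge[OF fin, of z'] by (fastforce simp: z_def)
    ultimately show ?thesis by (auto simp: R_def J_def)
  qed
  have H_fin: "finite (H z)" for z by (simp add: H_def)
  have l1: "(\<Sum>a\<in>H z. \<bar>entry x a\<bar>) \<le> 4 * norm (proj (H z) x)" if "z \<in> Z" for z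
  proof (rule sum_abs_entry_exp_le)
    have "4 \<le> z - 1" using Zp[OF that] p by simp
    from two_Suc_square_le[OF this] have "2 * z^2 \<le> 2 ^ (z - 1) * (z - 1)"
      using Zp[OF that] by simp
    thus "H z \<subseteq> {z - 1<..2 ^ (z - 1) * (z - 1)}" using Zp[OF that]
      by (auto simp: H_def J_def)
  qed
  define hd where "hd i z = (\<Sum>a\<in>H z. entry (y i) a)" for i z
  define tl where "tl i z = (\<Sum>s=1..k i. trunc_norm n (proj (E i s \<inter> T z) (y i)))" for i z
  have hd_nonneg: "0 \<le> hd i z" if "i \<in> I" for i z
    using pos[OF that] by (simp add: hd_def sum_nonneg)
  \<comment> \<open>In \<open>3 / 2\<close>, the 1 absorbs the single entry at \<open>m i\<close>,
    which lies in the head of its own interval, and the \<open>1 / 2\<close> comes from the heads of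
    the halved children.\<close>
  have single: "trunc_norm (Suc n) (y i) \<le> (\<Sum>z\<in>Z. 3 / 2 * hd i z) + (\<Sum>z\<in>R i. 1 / 2 * tl i z)"
    if i: "i \<in> I" for i
  proof -
    have RZ: "R i \<subseteq> Z" and R: "finite (R i)" using Z by (auto simp: R_def)
    have J_disj: "disjoint_family_on J (R i)"
      unfolding disjoint_family_on_def
    proof (intro ballI impI)
      fix z z' assume "z \<in> R i" "z' \<in> R i" "z \<noteq> z'"
      thus "J z \<inter> J z' = {}"
        using RZ J_lt[of z z'] J_lt[of z' z] by (meson disjoint_iff less_irrefl nat_neq_iff subsetD)
    qed
    have "trunc_norm n (proj (E i s) (y i)) \<le>
        (\<Sum>z\<in>R i. (\<Sum>a\<in>E i s \<inter> H z. entry (y i) a) + trunc_norm n (proj (E i s \<inter> T z) (y i)))"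
      if s: "s \<in> {1..k i}" for s
    proof -
      have "trunc_norm n (proj (E i s) (y i)) \<le> (\<Sum>z\<in>R i. trunc_norm n (proj (E i s \<inter> J z) (y i)))"
        using Em[OF i s] J_cover[OF i]
        by (intro seminorm_proj_le_sum is_seminorm_trunc R J_disj) blast
      also have "\<dots> \<le> (\<Sum>z\<in>R i. (\<Sum>a\<in>E i s \<inter> H z. entry (y i) a) +
          trunc_norm n (proj (E i s \<inter> T z) (y i)))"
      proof (rule sum_mono)
        fix z
        have "proj (E i s \<inter> J z) (y i) = proj (E i s \<inter> H z) (y i) + proj (E i s \<inter> T z) (y i)"
          by (rule c00_eqI) (auto simp: H_def T_def)
        hence "trunc_norm n (proj (E i s \<inter> J z) (y i)) \<le>
            trunc_norm n (proj (E i s \<inter> H z) (y i)) + trunc_norm n (proj (E i s \<inter> T z) (y i))"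
          by (simp add: is_seminormD[OF is_seminorm_trunc])
        also have "trunc_norm n (proj (E i s \<inter> H z) (y i)) \<le> (\<Sum>a\<in>E i s \<inter> H z. entry (y i) a)"
          using trunc_norm_proj_le_l1[of "E i s \<inter> H z" n "y i"] H_fin pos[OF i] by simp
        finally show "trunc_norm n (proj (E i s \<inter> J z) (y i)) \<le>
            (\<Sum>a\<in>E i s \<inter> H z. entry (y i) a) + trunc_norm n (proj (E i s \<inter> T z) (y i))"
          by simp
      qed
      finally show ?thesis .
    qed
    hence "(\<Sum>s=1..k i. trunc_norm n (proj (E i s) (y i))) \<le>
        (\<Sum>s=1..k i. \<Sum>z\<in>R i. (\<Sum>a\<in>E i s \<inter> H z. entry (y i) a) +
          trunc_norm n (proj (E i s \<inter> T z) (y i)))"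
      by (rule sum_mono)
    also have "\<dots> = (\<Sum>z\<in>R i. (\<Sum>s=1..k i. \<Sum>a\<in>E i s \<inter> H z. entry (y i) a) + tl i z)"
      unfolding tl_def by (subst sum.swap) (simp add: sum.distrib)
    also have "\<dots> \<le> (\<Sum>z\<in>R i. hd i z + tl i z)"
    proof (intro sum_mono add_right_mono)
      fix z
      \<comment> \<open>The sets \<open>E i s\<close> are disjoint in \<open>s\<close>, so all
        children together use each entry of the head at most once.\<close>
      have "(\<Sum>s=1..k i. \<Sum>a\<in>E i s \<inter> H z. entry (y i) a) =
          (\<Sum>a\<in>(\<Union>s\<in>{1..k i}. E i s \<inter> H z). entry (y i) a)"
        using disj[OF i] H_fin
        by (intro sum.UNION_disjoint[symmetric]) (auto simp: disjoint_family_on_def)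
      also have "\<dots> \<le> hd i z"
        unfolding hd_def using pos[OF i] H_fin by (intro sum_mono2) auto
      finally show "(\<Sum>s=1..k i. \<Sum>a\<in>E i s \<inter> H z. entry (y i) a) \<le> hd i z" .
    qed
    also have "\<dots> = (\<Sum>z\<in>R i. hd i z) + (\<Sum>z\<in>R i. tl i z)" by (rule sum.distrib)
    also have "(\<Sum>z\<in>R i. hd i z) \<le> (\<Sum>z\<in>Z. hd i z)"
      using Z RZ hd_nonneg[OF i] by (intro sum_mono2) auto
    finally have node: "(\<Sum>s=1..k i. trunc_norm n (proj (E i s) (y i))) \<le>
        (\<Sum>z\<in>Z. hd i z) + (\<Sum>z\<in>R i. tl i z)" by simp
    have mi: "m i \<in> Z" "m i \<in> H (m i)"
      using i by (auto simp: Z_def H_def J_def power2_eq_square)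
    have "\<bar>entry (y i) (m i)\<bar> \<le> hd i (m i)"
      unfolding hd_def using member_le_sum[OF mi(2), of "entry (y i)"] H_fin pos[OF i] by simp
    also have "\<dots> \<le> (\<Sum>z\<in>Z. hd i z)"
      using member_le_sum[OF mi(1), of "hd i"] Z hd_nonneg[OF i] by simp
    finally show ?thesis
      using bound[OF i] node unfolding sum_distrib_left[symmetric] by linarith
  qed
  have heads: "(\<Sum>i\<in>I. hd i z) \<le> 4 * norm (proj (H z) x)" if "z \<in> Z" for z
  proof -
    have "(\<Sum>i\<in>I. hd i z) = (\<Sum>a\<in>H z. \<Sum>i\<in>I. entry (y i) a)"
      unfolding hd_def by (rule sum.swap)
    also have "\<dots> \<le> (\<Sum>a\<in>H z. \<bar>entry x a\<bar>)"
      by (rule sum_mono) (use le order_trans abs_ge_self in blast)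
    also note l1[OF that]
    finally show ?thesis .
  qed
  have tails: "(\<Sum>i\<in>{i. i \<in> I \<and> m i \<le> z}. tl i z) \<le> 12 * norm (proj (T z) x)" if z: "z \<in> Z" for z
  proof -
    define K where "K = (SIGMA i:{i. i \<in> I \<and> m i \<le> z}. {1..k i})"
    \<comment> \<open>The children are renumbered by \<open>prod_encode\<close>, since the induction
      hypothesis speaks of families indexed by natural numbers.\<close>
    define w where "w c = (case prod_decode c of (i, s) \<Rightarrow> proj (E i s \<inter> T z) (y i))" for c
    have Kfin: "finite K" using I by (auto simp: K_def)
    have inj: "inj_on prod_encode K" by (rule inj_prod_encode)
    have "(\<Sum>i\<in>{i. i \<in> I \<and> m i \<le> z}. tl i z) = (\<Sum>(i,s)\<in>K. trunc_norm n (proj (E i s \<inter> T z) (y i)))"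
      unfolding tl_def K_def by (rule sum.Sigma) (use I in simp_all)
    also have "\<dots> = (\<Sum>c\<in>prod_encode ` K. trunc_norm n (w c))"
      by (subst sum.reindex[OF inj]) (simp add: w_def case_prod_unfold)
    also have "\<dots> \<le> 12 * norm (proj (T z) x)"
    \<comment> \<open>At most \<open>card I\<close> vectors have fewer than \<open>z\<close>
      children each, and \<open>card I \<le> p < z\<close>. So there are at most \<open>z^2\<close>
      children, exactly what the threshold \<open>2 * z^2\<close> admits.\<close>
    proof (rule Suc.IH[where p = "2 * z^2"])
      show "finite (prod_encode ` K)" using Kfin by simp
      have "card K = (\<Sum>i\<in>{i. i \<in> I \<and> m i \<le> z}. k i)"
        unfolding K_def using I by (subst card_SigmaI) auto
      also have "\<dots> \<le> (\<Sum>i\<in>{i. i \<in> I \<and> m i \<le> z}. z)"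
        by (rule sum_mono) (use km in fastforce)
      also have "\<dots> \<le> card I * z" using I by (auto intro: card_mono)
      also have "\<dots> \<le> z * z" using p Zp[OF z] by (intro mult_right_mono) auto
      finally show "2 * card (prod_encode ` K) \<le> 2 * z^2"
        by (simp add: card_image[OF inj] power2_eq_square)
      show "4 \<le> 2 * z^2"
        using p Zp[OF z] mult_mono[of 4 z 4 z] by (simp add: power2_eq_square)
      show "supp (w c) \<subseteq> {2 * z^2<..}" if "c \<in> prod_encode ` K" for c
        by (auto simp: w_def supp_def T_def split: prod.splits if_splits)
      show "0 \<le> entry (w c) a" if "c \<in> prod_encode ` K" for c a
        using that pos by (auto simp: w_def K_def)
      show "(\<Sum>c\<in>prod_encode ` K. entry (w c) a) \<le> entry (proj (T z) x) a" for a
      proof (cases "a \<in> T z")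
        case True
        have "(\<Sum>c\<in>prod_encode ` K. entry (w c) a) =
            (\<Sum>(i,s)\<in>K. if a \<in> E i s then entry (y i) a else 0)"
          by (subst sum.reindex[OF inj]) (auto simp: w_def True intro!: sum.cong)
        also have "\<dots> = (\<Sum>i\<in>{i. i \<in> I \<and> m i \<le> z}. \<Sum>s=1..k i. if a \<in> E i s then entry (y i) a else 0)"
          unfolding K_def by (rule sum.Sigma[symmetric]) (use I in simp_all)
        also have "\<dots> \<le> (\<Sum>i\<in>{i. i \<in> I \<and> m i \<le> z}. entry (y i) a)"
        proof (rule sum_mono)
          fix i assume "i \<in> {i. i \<in> I \<and> m i \<le> z}"
          hence i: "i \<in> I" by simp
          have sub: "s = t" if "s \<in> {1..k i}" "t \<in> {1..k i}" "a \<in> E i s" "a \<in> E i t" for s t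
            using disjoint_family_onD[OF disj[OF i] that(1,2)] that(3,4) by blast
          \<comment> \<open>By disjointness at most one child of \<open>y i\<close> sees the
            coordinate \<open>a\<close>, so the children never add up to more than
            \<open>y i\<close>.\<close>
          have "card {s \<in> {1..k i}. a \<in> E i s} \<le> Suc 0"
            by (subst card_le_Suc0_iff_eq) (simp, use sub in blast)
          hence "real (card {s \<in> {1..k i}. a \<in> E i s}) * entry (y i) a \<le> 1 * entry (y i) a"
            using pos[OF i] by (intro mult_right_mono) auto
          thus "(\<Sum>s=1..k i. if a \<in> E i s then entry (y i) a else 0) \<le> entry (y i) a"
            by (simp add: sum.inter_filter[symmetric])
        qed
        also have "\<dots> \<le> (\<Sum>i\<in>I. entry (y i) a)"
          using I pos by (intro sum_mono2) auto
        also note le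
        finally show ?thesis using True by simp
      next
        case False
        thus ?thesis by (auto simp: w_def split: prod.splits intro!: sum_nonpos)
      qed
    qed
    finally show ?thesis .
  qed
  have succ: "(\<Sum>z\<in>Z. norm (proj (H z) x) + norm (proj (T z) x)) \<le> 2 * norm x"
  proof -
    \<comment> \<open>Even labels stand for heads and odd labels for tails, so the numerical order
      of labels is the order of the sets. There are \<open>2 * card Z\<close> of them, which is why
      the hypothesis bounds \<open>2 * card I\<close> by \<open>p\<close>.\<close>
    define W where "W = (\<lambda>z. 2 * z) ` Z \<union> (\<lambda>z. 2 * z + 1) ` Z"
    define G where "G v = (if even v then H (v div 2) else T (v div 2))" for v
    have GJ: "G v \<subseteq> J (v div 2)" for v by (auto simp: G_def H_def T_def)
    have Wd: "v div 2 \<in> Z" if "v \<in> W" for v using that by (auto simp: W_def)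
    have inj: "inj_on (\<lambda>z. 2 * z) Z" "inj_on (\<lambda>z. 2 * z + 1) Z" by (auto simp: inj_on_def)
    have "(\<Sum>v\<in>W. norm (proj (G v) x)) =
        (\<Sum>v\<in>(\<lambda>z. 2 * z) ` Z. norm (proj (G v) x)) + (\<Sum>v\<in>(\<lambda>z. 2 * z + 1) ` Z. norm (proj (G v) x))"
      unfolding W_def using Z by (intro sum.union_disjoint) (auto, presburger)
    also have "\<dots> = (\<Sum>z\<in>Z. norm (proj (H z) x)) + (\<Sum>z\<in>Z. norm (proj (T z) x))"
      by (subst (1 2) sum.reindex) (use inj in \<open>auto simp: G_def\<close>)
    finally have eq: "(\<Sum>z\<in>Z. norm (proj (H z) x) + norm (proj (T z) x)) = (\<Sum>v\<in>W. norm (proj (G v) x))"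
      by (simp add: sum.distrib)
    show ?thesis unfolding eq
    proof (rule sum_norm_proj_successive_le)
      show "finite W" using Z by (simp add: W_def)
      have "card W \<le> card ((\<lambda>z. 2 * z) ` Z) + card ((\<lambda>z. 2 * z + 1) ` Z)"
        unfolding W_def by (rule card_Un_le)
      also have "\<dots> = 2 * card Z" using inj by (simp add: card_image)
      finally show "card W \<le> p" using Z(2) by simp
      show "G v \<subseteq> {p<..}" if "v \<in> W" for v
        using GJ[of v] Zp[OF Wd[OF that]] by (auto simp: J_def)
      show "a < b" if "v \<in> W" "v' \<in> W" "v < v'" "a \<in> G v" "b \<in> G v'" for v v' a b
      proof (cases "v div 2 = v' div 2")
        case True
        hence "even v" "odd v'" using that(3) by presburger+
        thus ?thesis using that(4,5) True by (auto simp: G_def H_def T_def)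
      next
        case False
        hence "v div 2 < v' div 2" using that(3) by linarith
        thus ?thesis using J_lt Wd that GJ by blast
      qed
    qed
  qed
  have "(\<Sum>i\<in>I. trunc_norm (Suc n) (y i)) \<le>
      (\<Sum>i\<in>I. (\<Sum>z\<in>Z. 3 / 2 * hd i z) + (\<Sum>z\<in>R i. 1 / 2 * tl i z))"
    by (rule sum_mono) (rule single)
  also have "\<dots> = (\<Sum>z\<in>Z. \<Sum>i\<in>I. 3 / 2 * hd i z) +
      (\<Sum>z\<in>Z. \<Sum>i\<in>{i. i \<in> I \<and> m i \<le> z}. 1 / 2 * tl i z)"
    unfolding sum.distrib R_def using I Z(1)
    by (intro arg_cong2[where f = "(+)"] sum.swap sum.swap_restrict)
  also have "\<dots> = (\<Sum>z\<in>Z. 3 / 2 * (\<Sum>i\<in>I. hd i z) + 1 / 2 * (\<Sum>i\<in>{i. i \<in> I \<and> m i \<le> z}. tl i z))"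
    by (simp only: sum.distrib sum_distrib_left)
  \<comment> \<open>Heads give \<open>3 / 2 * 4 = 6\<close> and tails \<open>1 / 2 * 12 = 6\<close>.
    The factor 2 from \<open>succ\<close> then returns the constant 12, so the induction closes
    without loss.\<close>
  also have "\<dots> \<le> (\<Sum>z\<in>Z. 6 * (norm (proj (H z) x) + norm (proj (T z) x)))"
  proof (rule sum_mono)
    fix z assume "z \<in> Z"
    from heads[OF this] tails[OF this]
    show "3 / 2 * (\<Sum>i\<in>I. hd i z) + 1 / 2 * (\<Sum>i\<in>{i. i \<in> I \<and> m i \<le> z}. tl i z) \<le>
        6 * (norm (proj (H z) x) + norm (proj (T z) x))" by simp
  qed
  also have "\<dots> \<le> 12 * norm x" using succ unfolding sum_distrib_left[symmetric] by linarith
  finally show ?case .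
qed

text \<open>The bound for the truncated norms is uniform in the level, so it passes to the
  limit.\<close>

lemma sum_norm_far_le:
  fixes y :: "nat \<Rightarrow> c00"
  assumes "finite I" "2 * card I \<le> p" "4 \<le> p"
    and "\<And>i. i \<in> I \<Longrightarrow> supp (y i) \<subseteq> {p<..}"
    and "\<And>i a. i \<in> I \<Longrightarrow> 0 \<le> entry (y i) a"
    and "\<And>a. (\<Sum>i\<in>I. entry (y i) a) \<le> entry x a"
  shows "(\<Sum>i\<in>I. norm (y i)) \<le> 12 * norm x"
proof (rule LIMSEQ_le_const2)
  show "(\<lambda>n. \<Sum>i\<in>I. norm_iter n (y i)) \<longlonglongrightarrow> (\<Sum>i\<in>I. norm (y i))"
    unfolding norm_eq_norm_lim by (intro tendsto_sum norm_iter_tendsto)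
  have "(\<Sum>i\<in>I. norm_iter n (y i)) \<le> 12 * norm x" for n
    using sum_trunc_norm_le[OF assms, of "Suc n"] by simp
  thus "\<exists>N. \<forall>n\<ge>N. (\<Sum>i\<in>I. norm_iter n (y i)) \<le> 12 * norm x" by blast
qed

lemma norm_proj_le_l1:
  fixes x :: c00
  assumes "finite F"
  shows "norm (proj F x) \<le> (\<Sum>a\<in>F. \<bar>entry x a\<bar>)"
  unfolding norm_eq_norm_lim
  by (rule LIMSEQ_le_const2[OF norm_iter_tendsto])
    (use trunc_norm_proj_le_l1[OF assms, of "Suc _" x] in auto)


section \<open>The logarithmic lower estimate\<close>

lemma sum_norm_le_c00:
  fixes y :: "nat \<Rightarrow> c00"
  assumes n: "2 \<le> n" and pos: "\<And>i a. i \<in> {1..n} \<Longrightarrow> 0 \<le> entry (y i) a"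
  shows "(\<Sum>i=1..n. norm (y i)) \<le> 19 / ln 2 * ln (real n) * norm (\<Sum>i=1..n. y i)"
proof -
  define x where "x = (\<Sum>i=1..n. y i)"
  \<comment> \<open>The extra 1 doubles the power of two, giving \<open>2 * n \<le> p\<close> and,
    as \<open>n \<ge> 2\<close>, also \<open>4 \<le> p\<close>.\<close>
  define l where "l = nat \<lceil>log 2 (real n)\<rceil> + 1"
  define p :: nat where "p = 2 ^ l"
  have log1: "1 \<le> log 2 (real n)" using n by (simp add: le_log_iff)
  \<comment> \<open>Rounding up and adding 1 costs at most 2, and \<open>log 2 (real n)\<close> is
    at least 1.\<close>
  have l_le: "real l \<le> 3 * log 2 (real n)" using log1 unfolding l_def by linarith
  have "real n = 2 powr log 2 (real n)" using n by simp
  also have "\<dots> \<le> 2 powr real (nat \<lceil>log 2 (real n)\<rceil>)" by (intro powr_mono) linarith+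
  finally have "real n \<le> 2 ^ nat \<lceil>log 2 (real n)\<rceil>" by (simp add: powr_realpow)
  hence "n \<le> 2 ^ nat \<lceil>log 2 (real n)\<rceil>"
    by (metis of_nat_le_iff of_nat_numeral of_nat_power)
  hence p: "2 * n \<le> p" by (simp add: p_def l_def)
  have ent: "(\<Sum>i=1..n. entry (y i) a) = entry x a" for a by (simp add: x_def entry_sum)
  have "norm (y i) \<le> norm (proj {1..p} (y i)) + norm (proj {p<..} (y i))" for i
  proof -
    have "y i = proj {1..p} (y i) + proj {p<..} (y i)"
    proof (rule c00_eqI)
      fix a
      show "entry (y i) a = entry (proj {1..p} (y i) + proj {p<..} (y i)) a"
        by (cases "a = 0") auto
    qed
    thus ?thesis using norm_triangle_ineq by metis
  qed
  hence "(\<Sum>i=1..n. norm (y i)) \<le>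
      (\<Sum>i=1..n. norm (proj {1..p} (y i))) + (\<Sum>i=1..n. norm (proj {p<..} (y i)))"
    unfolding sum.distrib[symmetric] by (rule sum_mono)
  moreover have "(\<Sum>i=1..n. norm (proj {p<..} (y i))) \<le> 12 * norm x"
  proof (rule sum_norm_far_le)
    show "(\<Sum>i=1..n. entry (proj {p<..} (y i)) a) \<le> entry x a" for a
      unfolding ent[symmetric] using pos by (intro sum_mono) simp
  qed (use n p pos in \<open>auto simp: supp_def split: if_splits\<close>)
  moreover have "(\<Sum>i=1..n. norm (proj {1..p} (y i))) \<le> (1 + 2 * real l) * norm x"
  proof -
    have "(\<Sum>i=1..n. norm (proj {1..p} (y i))) \<le> (\<Sum>i=1..n. \<Sum>a=1..p. \<bar>entry (y i) a\<bar>)"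
      by (intro sum_mono norm_proj_le_l1) simp
    \<comment> \<open>Positivity removes the absolute values, so the l1-norms of the
      \<open>y i\<close> on the initial segment add up to that of \<open>x\<close>.\<close>
    also have "\<dots> = (\<Sum>i=1..n. \<Sum>a=1..p. entry (y i) a)"
      using pos by (intro sum.cong refl) simp
    also have "\<dots> = (\<Sum>a=1..p. entry x a)" unfolding ent[symmetric] by (rule sum.swap)
    also have "\<dots> \<le> (\<Sum>a=1..p. \<bar>entry x a\<bar>)" by (rule sum_mono) simp
    also have "\<dots> \<le> (1 + 2 * real l) * norm x"
      unfolding p_def by (rule sum_abs_entry_initial_le)
    finally show ?thesis .
  qed
  ultimately have "(\<Sum>i=1..n. norm (y i)) \<le> (13 + 2 * real l) * norm x"
    by (simp add: algebra_simps)
  \<comment> \<open>Here \<open>13 = 12 + 1\<close> is at most 13 logarithms and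
    \<open>2 * real l\<close> at most 6.\<close>
  also have "\<dots> \<le> (19 * log 2 (real n)) * norm x"
    using l_le log1 by (intro mult_right_mono) auto
  finally show ?thesis by (simp add: x_def log_def)
qed

section \<open>Passage to the completion\<close>

lemma positive_vec_approx:
  assumes "positive_vec x"
  shows "\<exists>y. (\<forall>l a. 0 \<le> entry (y l) a) \<and> (\<lambda>l. to_completion (y l)) \<longlonglongrightarrow> x"
proof (intro exI conjI allI)
  \<comment> \<open>Partial sums of the basis expansion converge to \<open>x\<close> and inherit the
    signs of its coordinates.\<close>
  define y where "y l = (\<Sum>i<l. coord x (Suc i) *\<^sub>R unit_vec (Suc i))" for l
  show "0 \<le> entry (y l) a" for l a
    using assms by (auto simp: y_def entry_sum positive_vec_def intro!: sum_nonneg)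
  show "(\<lambda>l. to_completion (y l)) \<longlonglongrightarrow> x"
    using is_expansion_coord[of x]
    by (simp add: is_expansion_def sums_def y_def to_completion_sum to_completion_linear basis_vec_def)
qed

theorem mainTheorem6:
  shows "\<exists>B::real. B > 0 \<and>
    (\<forall>n\<ge>2. \<forall>x :: nat \<Rightarrow> tsirelson. (\<forall>i\<in>{1..n}. positive_vec (x i)) \<longrightarrow>
      norm (\<Sum>i=1..n. x i) \<ge> (\<Sum>i=1..n. norm (x i)) / (B * ln (real n)))"
proof (intro exI conjI allI impI)
  show "19 / ln 2 > (0::real)" by simp
  fix n :: nat and x :: "nat \<Rightarrow> tsirelson"
  assume n: "2 \<le> n" and x: "\<forall>i\<in>{1..n}. positive_vec (x i)"
  have "\<forall>i\<in>{1..n}. \<exists>y. (\<forall>l a. 0 \<le> entry (y l) a) \<and> (\<lambda>l. to_completion (y l)) \<longlonglongrightarrow> x i"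
    using x positive_vec_approx by blast
  from bchoice[OF this] obtain y
    where pos: "\<And>i l a. i \<in> {1..n} \<Longrightarrow> 0 \<le> entry (y i l) a"
      and lim: "\<And>i. i \<in> {1..n} \<Longrightarrow> (\<lambda>l. to_completion (y i l)) \<longlonglongrightarrow> x i"
    by blast
  \<comment> \<open>Both sides are continuous in the vectors and the embedding is isometric, so the
    estimate for finitely supported vectors survives the limit.\<close>
  have "(\<Sum>i=1..n. norm (x i)) \<le> 19 / ln 2 * ln (real n) * norm (\<Sum>i=1..n. x i)"
  proof (rule LIMSEQ_le)
    show "(\<lambda>l. \<Sum>i=1..n. norm (to_completion (y i l))) \<longlonglongrightarrow> (\<Sum>i=1..n. norm (x i))"
      by (intro tendsto_sum tendsto_norm lim)
    show "(\<lambda>l. 19 / ln 2 * ln (real n) * norm (\<Sum>i=1..n. to_completion (y i l)))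
        \<longlonglongrightarrow> 19 / ln 2 * ln (real n) * norm (\<Sum>i=1..n. x i)"
      by (intro tendsto_intros lim)
    have "(\<Sum>i=1..n. norm (to_completion (y i l))) \<le>
        19 / ln 2 * ln (real n) * norm (\<Sum>i=1..n. to_completion (y i l))" for l
      using sum_norm_le_c00[OF n, of "\<lambda>i. y i l"] pos by (simp add: to_completion_sum[symmetric])
    thus "\<exists>N. \<forall>l\<ge>N. (\<Sum>i=1..n. norm (to_completion (y i l))) \<le>
        19 / ln 2 * ln (real n) * norm (\<Sum>i=1..n. to_completion (y i l))" by blast
  qed
  moreover have B: "0 < 19 / ln 2 * ln (real n)" using n by simp
  ultimately show "norm (\<Sum>i=1..n. x i) \<ge> (\<Sum>i=1..n. norm (x i)) / (19 / ln 2 * ln (real n))"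
    unfolding pos_divide_le_eq[OF B] by (simp only: mult.commute)
qed

end
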